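(* For any fixed integer $k\ge 0$, there is a comparison-based deterministic RAM algorithm that computes $F_k^{\boxplus n}$ on inputs of length $2n-1$ with time $T$ and space $S$ satisfying $T\cdot S\in O(n^2\log^2 n)$, for every space bound $S$ with $\log n\le S\le n$.
   Context: For a string $a$, $F_k(a)=\sum_{i\in D} f_i^k$ where $D$ is the set of symbols occurring in $a$ and $f_i$ the number of occurrences of $i$; $F_0(a)$ is the number of distinct symbols. $F_k^{\boxplus n}(x)=(F_k(x_i\ldots x_{i+n-1}))_{i=1}^n$ for $x=x_1\ldots x_{2n-1}$ over a linearly ordered alphabet. Space is measured in bits, excluding the read-only input and write-only output. A comparison-based algorithm accesses input values only through comparisons. *)

theory Defs
  imports Complex_Main "HOL-Library.Landau_Symbols"
begin

definition freq_moment :: "nat \<Rightarrow> 'a list \<Rightarrow> nat" where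
  "freq_moment k a = (\<Sum>i\<in>set a. count_list a i ^ k)"

lemma freq_moment_0: "freq_moment 0 a = card (set a)"
  by (simp add: freq_moment_def)

definition sliding_window :: "nat \<Rightarrow> ('a list \<Rightarrow> 'b) \<Rightarrow> 'a list \<Rightarrow> 'b list" where
  "sliding_window n f x = map (\<lambda>i. f (take n (drop i x))) [0..<n]"

text \<open>
  A comparison-based word RAM.  The working memory consists of \<open>m\<close> cells of \<open>w\<close> bits each,
  every instruction takes one time step, and the read-only input \<open>x\<close> can be inspected only by
  \<open>COMPARE\<close>, a three-way comparison of two of its entries.  The write-only output is a list
  that grows at its end.  Operands are cell addresses, except for the value in \<open>LITERAL\<close> and
  the jump targets.
\<close>

datatype instr =
    LITERAL nat nat
  | MOVE nat nat
  | ADD nat nat nat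
  | SUB nat nat nat
  | MUL nat nat nat
  | DIV nat nat nat
  | LOAD nat nat
  | STORE nat nat
  | COMPARE nat nat nat
  | JUMP nat
  | JUMPZ nat nat
  | OUTPUT nat
  | HALT

text \<open>Program counter, contents of the memory cells, output written so far.\<close>

type_synonym config = "nat \<times> (nat \<Rightarrow> nat) \<times> nat list"

definition three_way :: "'a::linorder \<Rightarrow> 'a \<Rightarrow> nat" where
  "three_way u v = (if u < v then 0 else if u = v then 1 else 2)"

text \<open>
  Stored values are reduced modulo \<open>2 ^ w\<close>; subtraction is cut off at \<open>0\<close>.  The result
  \<open>None\<close> means that the machine has no next configuration: it has halted, or it has failed by
  addressing a cell outside its \<open>m\<close> cells or a position outside the input.
\<close>

fun exec_instr ::
  "nat \<Rightarrow> nat \<Rightarrow> 'a::linorder list \<Rightarrow> instr \<Rightarrow> config \<Rightarrow> config option" where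
  "exec_instr w m x (LITERAL d v) (p, M, ys) =
     (if d < m then Some (Suc p, M(d := v mod 2 ^ w), ys) else None)"
| "exec_instr w m x (MOVE d a) (p, M, ys) =
     (if d < m \<and> a < m then Some (Suc p, M(d := M a), ys) else None)"
| "exec_instr w m x (ADD d a b) (p, M, ys) =
     (if d < m \<and> a < m \<and> b < m
      then Some (Suc p, M(d := (M a + M b) mod 2 ^ w), ys) else None)"
| "exec_instr w m x (SUB d a b) (p, M, ys) =
     (if d < m \<and> a < m \<and> b < m then Some (Suc p, M(d := M a - M b), ys) else None)"
| "exec_instr w m x (MUL d a b) (p, M, ys) =
     (if d < m \<and> a < m \<and> b < m
      then Some (Suc p, M(d := (M a * M b) mod 2 ^ w), ys) else None)"
| "exec_instr w m x (DIV d a b) (p, M, ys) =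
     (if d < m \<and> a < m \<and> b < m then Some (Suc p, M(d := M a div M b), ys) else None)"
| "exec_instr w m x (LOAD d a) (p, M, ys) =
     (if d < m \<and> a < m \<and> M a < m then Some (Suc p, M(d := M (M a)), ys) else None)"
| "exec_instr w m x (STORE a b) (p, M, ys) =
     (if a < m \<and> b < m \<and> M a < m then Some (Suc p, M(M a := M b), ys) else None)"
| "exec_instr w m x (COMPARE d a b) (p, M, ys) =
     (if d < m \<and> a < m \<and> b < m \<and> M a < length x \<and> M b < length x
      then Some (Suc p, M(d := three_way (x ! M a) (x ! M b) mod 2 ^ w), ys) else None)"
| "exec_instr w m x (JUMP l) (p, M, ys) = Some (l, M, ys)"
| "exec_instr w m x (JUMPZ a l) (p, M, ys) =
     (if a < m then Some (if M a = 0 then l else Suc p, M, ys) else None)"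
| "exec_instr w m x (OUTPUT a) (p, M, ys) =
     (if a < m then Some (Suc p, M, ys @ [M a]) else None)"
| "exec_instr w m x HALT c = None"

definition ram_step ::
  "instr list \<Rightarrow> nat \<Rightarrow> nat \<Rightarrow> 'a::linorder list \<Rightarrow> config \<Rightarrow> config option" where
  "ram_step P w m x c = (if fst c < length P then exec_instr w m x (P ! fst c) c else None)"

fun ram_steps ::
  "instr list \<Rightarrow> nat \<Rightarrow> nat \<Rightarrow> 'a::linorder list \<Rightarrow> nat \<Rightarrow> config \<Rightarrow> config option" where
  "ram_steps P w m x 0 c = Some c"
| "ram_steps P w m x (Suc t) c = Option.bind (ram_step P w m x c) (ram_steps P w m x t)"

text \<open>The parameters \<open>n\<close> and \<open>S\<close> are supplied in cells 0 and 1; all other cells start at 0.\<close>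

definition ram_init :: "nat \<Rightarrow> nat \<Rightarrow> nat \<Rightarrow> config" where
  "ram_init w n S = (0, (\<lambda>_. 0)(0 := n mod 2 ^ w, 1 := S mod 2 ^ w), [])"

definition ram_outputs_within ::
  "instr list \<Rightarrow> nat \<Rightarrow> nat \<Rightarrow> nat \<Rightarrow> nat \<Rightarrow> 'a::linorder list \<Rightarrow> nat \<Rightarrow> nat list \<Rightarrow> bool" where
  "ram_outputs_within P w m n S x T ys \<longleftrightarrow>
     (\<exists>t\<le>T. \<exists>p M. ram_steps P w m x t (ram_init w n S) = Some (p, M, ys) \<and>
        p < length P \<and> P ! p = HALT)"

text \<open>Space in bits: the memory cells together with the program counter.\<close>

definition ram_space :: "instr list \<Rightarrow> nat \<Rightarrow> nat \<Rightarrow> nat" where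
  "ram_space P w m = m * w + nat \<lceil>log 2 (length P)\<rceil>"

text \<open>Words are \<open>b\<close> times as long as the binary representation of \<open>n\<close>, hence \<open>\<Theta>(log n)\<close> bits.\<close>

definition word_bits :: "nat \<Rightarrow> nat \<Rightarrow> nat" where
  "word_bits b n = b * nat \<lceil>log 2 (real n + 1)\<rceil>"

definition space_bounds :: "(nat \<times> nat) set" where
  "space_bounds = {(n, S). 1 \<le> n \<and> log 2 (real n) \<le> real S \<and> S \<le> n}"

text \<open>
  The pairs \<open>(n, S)\<close> over which \<open>O(\<cdot>)\<close> is taken, with one constant for all of them.
  The case \<open>n = 1\<close> is left out because \<open>log n = 0\<close> there.
\<close>

definition asymp_range :: "(nat \<times> nat) filter" where
  "asymp_range = principal {(n, S) \<in> space_bounds. 2 \<le> n}"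

end

theory Submission
  imports Defs
begin

text \<open>
  The window is slid over the input one position at a time, starting from the empty window: step
  \<open>t\<close> removes \<open>x\<^sub>t\<^sub>-\<^sub>n\<close>, inserts \<open>x\<^sub>t\<close>, and updates \<open>F\<^sub>k\<close> from the frequency of the symbol concerned.
  The steps are grouped into blocks of length \<open>b = 2\<^sup>q\<close>, proportional to \<open>S / log n\<close>.  Only the \<open>2b\<close> symbols
  that enter or leave during a block need a counter.  Their positions are merge sorted, one scan
  of the window with binary search initialises the counters, and then the block is replayed.  A
  block costs \<open>O(n log n)\<close> steps and \<open>O(b)\<close> words of \<open>O(log n)\<close> bits, and there are \<open>O(n / b)\<close> blocks.

  The algorithm is written in a small while language with two arrays, which is compiled to the
  machine.
\<close>

section \<open>A while language for the machine\<close>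

text \<open>Since inputs can only be compared, a symbol is never stored; it is represented by an
  input position, and equality of symbols is decided by two comparisons. Equal keys may fill several
  slots of the sorted array, so one slot has to be singled out: the first.

  Symbols that neither enter nor leave keep their frequency throughout a block, so their share of
  \<open>F_k\<close> need not be known. Only the running value of \<open>F_k\<close> in
  \<open>RF\<close> survives from block to block; the counters are rebuilt each time.

  The product comes out because \<open>b\<close> is the largest power of two with
  \<open>b * lg n <= S\<close>: then \<open>S < 2 * b * lg n\<close>, and \<open>b\<close> cancels
  against the number of blocks. Near the lower end of the range \<open>S\<close> may be below
  \<open>lg n\<close>; then \<open>b = 1\<close>, and the constant number of words is still
  \<open>O(S)\<close> because \<open>log n <= S\<close>.

  Powers of two spare both the search and the merging all boundary cases. Since \<open>F_k\<close>
  can reach the order of \<open>n ^ (k + 1)\<close>, the word length must grow with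
  \<open>k\<close>; this is harmless because \<open>k\<close> is fixed.\<close>

datatype reg = RN | RS | RZero | ROne | RL | RV | RB | RNN | RE | REM | RF | RT | RTE
  | RH | RO | RI | RIE | RJ | RJE | RX | RY | RP | RPos | RStep | RG

text \<open>
  Cells 0 and 1 are prescribed by the initial configuration; cells 2 to 5 are reserved for the
  compiler, and the arrays start at cell 40.
\<close>

primrec addr :: "reg \<Rightarrow> nat" where
  "addr RN = 0" | "addr RS = 1" | "addr RZero = 6" | "addr ROne = 7" | "addr RL = 8"
| "addr RV = 9" | "addr RB = 10" | "addr RNN = 11" | "addr RE = 12" | "addr REM = 13"
| "addr RF = 14" | "addr RT = 15" | "addr RTE = 16" | "addr RH = 17" | "addr RO = 18"
| "addr RI = 19" | "addr RIE = 20" | "addr RJ = 21" | "addr RJE = 22" | "addr RX = 23"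
| "addr RY = 24" | "addr RP = 25" | "addr RPos = 26" | "addr RStep = 27" | "addr RG = 28"

lemma addr_inject [simp]: "addr r = addr r' \<longleftrightarrow> r = r'"
proof -
  \<comment> \<open>A left inverse of \<open>addr\<close>, which avoids comparing all pairs of
    registers. The entries at 2 to 5 are fillers for the reserved cells.\<close>
  define rs where "rs = [RN, RS, RN, RN, RN, RN, RZero, ROne, RL, RV, RB, RNN, RE, REM, RF, RT,
    RTE, RH, RO, RI, RIE, RJ, RJE, RX, RY, RP, RPos, RStep, RG]"
  have "rs ! addr q = q" for q
    by (cases q) (simp_all add: rs_def)
  then show ?thesis by metis
qed

lemma addr_less: "addr r < 40"
  by (cases r) simp_all

lemma addr_reserved: "addr r \<noteq> 2" "addr r \<noteq> 3" "addr r \<noteq> 4" "addr r \<noteq> 5"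
  by (cases r; simp)+

datatype oper = Lit reg nat | Mov reg reg | Add reg reg reg | Sub reg reg reg
  | Mul reg reg reg | Quot reg reg reg | GetA reg reg | GetB reg reg | PutA reg reg
  | PutB reg reg | Swap | Emit reg

text \<open>\<open>Lt\<close> compares register contents as numbers. \<open>Less\<close> compares
  the input entries at the positions held in the registers and is the only access to the
  input.\<close>

datatype test = Lt reg reg | Less reg reg

datatype com = SKIP | OP oper | SEQ com com (infixr \<open>;;\<close> 60)
  | IF test com com | WHILE test com

text \<open>Array accesses double the index because the arrays are interleaved with stride 2; cell 4
  is scratch space for the address.\<close>

fun oper_code :: "oper \<Rightarrow> instr list" where
  "oper_code (Lit d v) = [LITERAL (addr d) v]"
| "oper_code (Mov d a) = [MOVE (addr d) (addr a)]"
| "oper_code (Add d a b) = [ADD (addr d) (addr a) (addr b)]"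
| "oper_code (Sub d a b) = [SUB (addr d) (addr a) (addr b)]"
| "oper_code (Mul d a b) = [MUL (addr d) (addr a) (addr b)]"
| "oper_code (Quot d a b) = [DIV (addr d) (addr a) (addr b)]"
| "oper_code (GetA d i) = [ADD 4 (addr i) (addr i), ADD 4 2 4, LOAD (addr d) 4]"
| "oper_code (GetB d i) = [ADD 4 (addr i) (addr i), ADD 4 3 4, LOAD (addr d) 4]"
| "oper_code (PutA i a) = [ADD 4 (addr i) (addr i), ADD 4 2 4, STORE 4 (addr a)]"
| "oper_code (PutB i a) = [ADD 4 (addr i) (addr i), ADD 4 3 4, STORE 4 (addr a)]"
| "oper_code Swap = [MOVE 4 2, MOVE 2 3, MOVE 3 4]"
| "oper_code (Emit a) = [OUTPUT (addr a)]"

text \<open>Cell 4 ends up nonzero iff the test succeeds. For \<open>Less\<close> the three-way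
  result of comparing \<open>b\<close> with \<open>a\<close> is 2 exactly if the key at
  \<open>a\<close> is smaller, so cut-off subtraction of 1 leaves 0 in the other two cases.\<close>

fun branch_code :: "test \<Rightarrow> instr list" where
  "branch_code (Lt a b) = [SUB 4 (addr b) (addr a)]"
| "branch_code (Less a b) = [LITERAL 5 1, COMPARE 4 (addr b) (addr a), SUB 4 4 5]"

fun code_length :: "com \<Rightarrow> nat" where
  "code_length SKIP = 0"
| "code_length (OP f) = length (oper_code f)"
| "code_length (c ;; d) = code_length c + code_length d"
| "code_length (IF q c d) = length (branch_code q) + 2 + code_length c + code_length d"
| "code_length (WHILE q c) = length (branch_code q) + 2 + code_length c"

text \<open>Jump targets are absolute, so the address \<open>p\<close> of the first instruction is
  passed down; \<open>code_length\<close> does not depend on it and supplies forward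
  targets.\<close>

fun code :: "nat \<Rightarrow> com \<Rightarrow> instr list" where
  "code p SKIP = []"
| "code p (OP f) = oper_code f"
| "code p (c ;; d) = code p c @ code (p + code_length c) d"
| "code p (IF q c d) =
     (let l = length (branch_code q) in
      branch_code q @ [JUMPZ 4 (p + l + 2 + code_length c)] @ code (p + l + 1) c
      @ [JUMP (p + l + 2 + code_length c + code_length d)] @ code (p + l + 2 + code_length c) d)"
| "code p (WHILE q c) =
     (let l = length (branch_code q) in
      branch_code q @ [JUMPZ 4 (p + l + 2 + code_length c)] @ code (p + l + 1) c @ [JUMP p])"

lemma length_code [simp]: "length (code p c) = code_length c"
  by (induction c arbitrary: p) (simp_all add: Let_def)

definition code_at :: "instr list \<Rightarrow> nat \<Rightarrow> instr list \<Rightarrow> bool" where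
  "code_at P p is \<longleftrightarrow> p + length is \<le> length P \<and> take (length is) (drop p P) = is"

lemma code_at_append:
  "code_at P p (is @ js) \<longleftrightarrow> code_at P p is \<and> code_at P (p + length is) js"
  unfolding code_at_def by (auto simp: take_add add.commute add.left_commute)

lemma code_at_Nil: "code_at P p [] \<longleftrightarrow> p \<le> length P"
  by (simp add: code_at_def)

lemma code_at_Cons:
  "code_at P p (i # is) \<longleftrightarrow> p < length P \<and> P ! p = i \<and> code_at P (Suc p) is"
proof -
  have "code_at P p [i] \<longleftrightarrow> p < length P \<and> P ! p = i"
    unfolding code_at_def by (cases "p < length P") (auto simp flip: Cons_nth_drop_Suc)
  then show ?thesis
    using code_at_append[of P p "[i]" "is"] by simp
qed

text \<open>Registers, the two arrays, output, and an upper bound on the number of machine steps.\<close>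

type_synonym state = "(reg \<Rightarrow> nat) \<times> (nat \<Rightarrow> nat) \<times> (nat \<Rightarrow> nat) \<times> nat list \<times> nat"

lemma ram_steps_add:
  "ram_steps P w m x (t + u) c = Option.bind (ram_steps P w m x t c) (ram_steps P w m x u)"
  by (induction t arbitrary: c) (auto simp: bind_eq_None_conv split: option.splits Option.bind_splits)

lemma ram_steps_2:
  "ram_steps P w m x 2 c = Option.bind (ram_step P w m x c) (ram_step P w m x)"
proof -
  have "ram_steps P w m x (Suc 0) = ram_step P w m x" 
    by (intro ext, rename_tac c, case_tac "ram_step P w m x c") simp_all
  then show ?thesis unfolding numeral_2_eq_2 by (metis ram_steps.simps(2))
qed

lemma ram_steps_3:
  "ram_steps P w m x 3 c = Option.bind (ram_step P w m x c) (ram_steps P w m x 2)"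
  unfolding numeral_3_eq_3 numeral_2_eq_2 by (rule ram_steps.simps(2))

lemma ram_steps_4:
  "ram_steps P w m x 4 c = Option.bind (ram_step P w m x c) (ram_steps P w m x 3)"
  using ram_steps.simps(2)[of P w m x 3 c] by (simp del: ram_steps.simps)

text \<open>The machine has \<open>40 + 2 * cap\<close> cells, and the assumption makes each of
  their addresses fit into a word.\<close>

locale machine =
  fixes w cap :: nat and x :: "'a::linorder list"
  assumes cells: "40 + 2 * cap \<le> 2 ^ w"
begin

definition key :: "nat \<Rightarrow> 'a" where
  "key p = x ! p"

text \<open>
  An operation that would overflow a word or leave the arrays has no result, so a terminating
  execution never depends on the reduction modulo \<open>2 ^ w\<close>.  Every operation or test is charged
  5 steps, which covers the longest code of any of them.
\<close>

fun oper_step :: "oper \<Rightarrow> state \<Rightarrow> state option" where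
  "oper_step (Lit d v) (\<rho>, A, B, ys, \<tau>) =
     (if v < 2 ^ w then Some (\<rho>(d := v), A, B, ys, 5 + \<tau>) else None)"
| "oper_step (Mov d a) (\<rho>, A, B, ys, \<tau>) = Some (\<rho>(d := \<rho> a), A, B, ys, 5 + \<tau>)"
| "oper_step (Add d a b) (\<rho>, A, B, ys, \<tau>) =
     (if \<rho> a + \<rho> b < 2 ^ w then Some (\<rho>(d := \<rho> a + \<rho> b), A, B, ys, 5 + \<tau>) else None)"
| "oper_step (Sub d a b) (\<rho>, A, B, ys, \<tau>) = Some (\<rho>(d := \<rho> a - \<rho> b), A, B, ys, 5 + \<tau>)"
| "oper_step (Mul d a b) (\<rho>, A, B, ys, \<tau>) =
     (if \<rho> a * \<rho> b < 2 ^ w then Some (\<rho>(d := \<rho> a * \<rho> b), A, B, ys, 5 + \<tau>) else None)"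
| "oper_step (Quot d a b) (\<rho>, A, B, ys, \<tau>) = Some (\<rho>(d := \<rho> a div \<rho> b), A, B, ys, 5 + \<tau>)"
| "oper_step (GetA d i) (\<rho>, A, B, ys, \<tau>) =
     (if \<rho> i < cap then Some (\<rho>(d := A (\<rho> i)), A, B, ys, 5 + \<tau>) else None)"
| "oper_step (GetB d i) (\<rho>, A, B, ys, \<tau>) =
     (if \<rho> i < cap then Some (\<rho>(d := B (\<rho> i)), A, B, ys, 5 + \<tau>) else None)"
| "oper_step (PutA i a) (\<rho>, A, B, ys, \<tau>) =
     (if \<rho> i < cap then Some (\<rho>, A(\<rho> i := \<rho> a), B, ys, 5 + \<tau>) else None)"
| "oper_step (PutB i a) (\<rho>, A, B, ys, \<tau>) =
     (if \<rho> i < cap then Some (\<rho>, A, B(\<rho> i := \<rho> a), ys, 5 + \<tau>) else None)"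
| "oper_step Swap (\<rho>, A, B, ys, \<tau>) = Some (\<rho>, B, A, ys, 5 + \<tau>)"
| "oper_step (Emit a) (\<rho>, A, B, ys, \<tau>) = Some (\<rho>, A, B, ys @ [\<rho> a], 5 + \<tau>)"

fun test_ok :: "test \<Rightarrow> (reg \<Rightarrow> nat) \<Rightarrow> bool" where
  "test_ok (Lt a b) \<rho> \<longleftrightarrow> True"
| "test_ok (Less a b) \<rho> \<longleftrightarrow> \<rho> a < length x \<and> \<rho> b < length x"

fun test_val :: "test \<Rightarrow> (reg \<Rightarrow> nat) \<Rightarrow> bool" where
  "test_val (Lt a b) \<rho> \<longleftrightarrow> \<rho> a < \<rho> b"
| "test_val (Less a b) \<rho> \<longleftrightarrow> key (\<rho> a) < key (\<rho> b)"

inductive exec :: "com \<Rightarrow> state \<Rightarrow> state \<Rightarrow> bool" where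
  Skip: "exec SKIP s s"
| Op: "oper_step f s = Some s' \<Longrightarrow> exec (OP f) s s'"
| Seq: "exec c s s' \<Longrightarrow> exec d s' s'' \<Longrightarrow> exec (c ;; d) s s''"
| IfTrue: "test_ok q \<rho> \<Longrightarrow> test_val q \<rho> \<Longrightarrow> exec c (\<rho>, A, B, ys, 5 + \<tau>) s
    \<Longrightarrow> exec (IF q c d) (\<rho>, A, B, ys, \<tau>) s"
| IfFalse: "test_ok q \<rho> \<Longrightarrow> \<not> test_val q \<rho> \<Longrightarrow> exec d (\<rho>, A, B, ys, 5 + \<tau>) s
    \<Longrightarrow> exec (IF q c d) (\<rho>, A, B, ys, \<tau>) s"
| WhileTrue: "test_ok q \<rho> \<Longrightarrow> test_val q \<rho> \<Longrightarrow> exec c (\<rho>, A, B, ys, 5 + \<tau>) s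
    \<Longrightarrow> exec (WHILE q c) s s' \<Longrightarrow> exec (WHILE q c) (\<rho>, A, B, ys, \<tau>) s'"
| WhileFalse: "test_ok q \<rho> \<Longrightarrow> \<not> test_val q \<rho>
    \<Longrightarrow> exec (WHILE q c) (\<rho>, A, B, ys, \<tau>) (\<rho>, A, B, ys, 5 + \<tau>)"

text \<open>
  The arrays are interleaved, so their addresses do not depend on their length, and cells 2 and 3
  hold the two base addresses, so that \<open>Swap\<close> takes constant time.
\<close>

definition represents ::
    "(nat \<Rightarrow> nat) \<Rightarrow> (reg \<Rightarrow> nat) \<Rightarrow> (nat \<Rightarrow> nat) \<Rightarrow> (nat \<Rightarrow> nat) \<Rightarrow> bool" where
  "represents M \<rho> A B \<longleftrightarrow> (\<forall>r. M (addr r) = \<rho> r) \<and>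
     (\<exists>a b. {a, b} = {40, 41} \<and> M 2 = a \<and> M 3 = b \<and>
       (\<forall>i<cap. M (a + 2 * i) = A i \<and> M (b + 2 * i) = B i))"

abbreviation steps :: "instr list \<Rightarrow> nat \<Rightarrow> config \<Rightarrow> config option" where
  "steps P \<equiv> ram_steps P w (40 + 2 * cap) x"

definition reaches :: "instr list \<Rightarrow> nat \<Rightarrow> (nat \<Rightarrow> nat) \<Rightarrow> nat list \<Rightarrow> nat \<Rightarrow> nat \<Rightarrow> state \<Rightarrow> bool" where
  "reaches P p M ys \<tau> p' s \<longleftrightarrow> (case s of (\<rho>', A', B', ys', \<tau>') \<Rightarrow>
     \<exists>t M'. steps P t (p, M, ys) = Some (p', M', ys') \<and> \<tau> + t \<le> \<tau>' \<and> represents M' \<rho>' A' B')"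

lemma reachesI:
  assumes "steps P t (p, M, ys) = Some (p', M', ys')" "\<tau> + t \<le> \<tau>'" "represents M' \<rho>' A' B'"
  shows "reaches P p M ys \<tau> p' (\<rho>', A', B', ys', \<tau>')"
  using assms by (auto simp: reaches_def)

lemma represents_reg: "represents M \<rho> A B \<Longrightarrow> M (addr r) = \<rho> r"
  by (simp add: represents_def)

lemma represents_upd_reg:
  assumes "represents M \<rho> A B" shows "represents (M(addr d := v)) (\<rho>(d := v)) A B"
proof -
  have "40 + 2 * i \<noteq> addr d" "41 + 2 * i \<noteq> addr d" for i
    using addr_less[of d] by auto
  then show ?thesis
    using assms addr_reserved[of d] addr_reserved(1,2)[of d, symmetric]
    unfolding represents_def by (auto simp: doubleton_eq_iff)
qed

lemma represents_upd_temp: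
  assumes "represents M \<rho> A B" "c = 4 \<or> c = 5" shows "represents (M(c := v)) \<rho> A B"
  using assms addr_reserved unfolding represents_def by (auto simp: doubleton_eq_iff)

lemma represents_swap:
  assumes "represents M \<rho> A B" shows "represents (M(2 := M 3, 3 := M 2)) \<rho> B A"
  using assms addr_reserved unfolding represents_def by (auto simp: doubleton_eq_iff)

lemma represents_getA: "represents M \<rho> A B \<Longrightarrow> i < cap \<Longrightarrow> M (M 2 + 2 * i) = A i"
  by (auto simp: represents_def)

lemma represents_bases:
  "represents M \<rho> A B \<Longrightarrow> M 2 = 40 \<and> M 3 = 41 \<or> M 2 = 41 \<and> M 3 = 40"
  by (auto simp: represents_def doubleton_eq_iff)

lemma represents_putA:
  assumes r: "represents M \<rho> A B" and i: "i < cap"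
  shows "represents (M(M 2 + 2 * i := v)) \<rho> (A(i := v)) B"
proof -
  have *: "addr r \<noteq> 40 + 2 * i" "addr r \<noteq> 41 + 2 * i" for r i
    using addr_less[of r] by auto
  \<comment> \<open>The arrays occupy cells of different parity, so a write to one leaves the other
    intact.\<close>
  have p: "40 + 2 * i \<noteq> 41 + 2 * j" "41 + 2 * j \<noteq> 40 + 2 * i" for i j :: nat
    by presburger+
  show ?thesis
    using r i * p unfolding represents_def by (auto simp: doubleton_eq_iff)
qed

lemma represents_getB: "represents M \<rho> A B \<Longrightarrow> i < cap \<Longrightarrow> M (M 3 + 2 * i) = B i"
  using represents_getA[OF represents_swap] by (auto simp: represents_def)

lemma represents_putB:
  assumes r: "represents M \<rho> A B" and i: "i < cap"
  shows "represents (M(M 3 + 2 * i := v)) \<rho> A (B(i := v))"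
proof -
  \<comment> \<open>Exchanging the two bases before and after the write reduces the claim to
    \<open>represents_putA\<close>.\<close>
  let ?M = "M(2 := M 3, 3 := M 2)"
  let ?M' = "?M(?M 2 + 2 * i := v)"
  have "represents (?M'(2 := ?M' 3, 3 := ?M' 2)) \<rho> A (B(i := v))"
    by (intro represents_swap represents_putA r i)
  also have "?M'(2 := ?M' 3, 3 := ?M' 2) = M(M 3 + 2 * i := v)"
    using represents_bases[OF r] by (auto simp: fun_eq_iff)
  finally show ?thesis .
qed

lemma addr_less_cells: "addr r < 40 + 2 * cap"
  using addr_less[of r] by simp

lemma steps_1: "steps P 1 c = ram_step P w (40 + 2 * cap) x c"
  by (cases "ram_step P w (40 + 2 * cap) x c") simp_all

lemma oper_code_correct:
  assumes r: "represents M \<rho> A B" and c: "code_at P p (oper_code f)"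
    and s: "oper_step f (\<rho>, A, B, ys, \<tau>) = Some s"
  shows "reaches P p M ys \<tau> (p + length (oper_code f)) s"
proof -
  note [simp] = addr_less_cells represents_reg[OF r] ram_step_def code_at_Cons code_at_Nil addr_reserved
  \<comment> \<open>The address computation shared by all four array operations. The result is at
    most \<open>39 + 2 * cap\<close>, so nothing is reduced modulo \<open>2 ^ w\<close>.\<close>
  have array: "steps P 2 (p, M, ys) = Some (p + 2, M(4 := M b + 2 * \<rho> i), ys)"
    if "code_at P p [ADD 4 (addr i) (addr i), ADD 4 b 4]" "\<rho> i < cap" "b = 2 \<or> b = 3" for i b
  proof -
    have b: "M b + 2 * \<rho> i < 2 ^ w" "2 * \<rho> i < 2 ^ w"
      using that cells represents_bases[OF r] by auto
    show ?thesis
      using that b by (auto simp: ram_steps_2 mult_2[symmetric])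
  qed
  have r4: "represents (M(4 := v)) \<rho> A B" for v
    using r by (rule represents_upd_temp) simp
  have single: "reaches P p M ys \<tau> (Suc p) (\<rho>', A', B', ys', 5 + \<tau>)"
    if "represents M' \<rho>' A' B'" "code_at P p [i]"
      "exec_instr w (40 + 2 * cap) x i (p, M, ys) = Some (Suc p, M', ys')"
    for M' \<rho>' A' B' ys' i
    using that by (intro reachesI[of _ 1]) simp_all
  show ?thesis
  proof (cases f)
    case (Lit d v)
    then show ?thesis
      using c s represents_upd_reg[OF r, of d "v"]
      by (auto intro!: single[of "M(addr d := v)" _ _ _ "oper_code f ! 0"] split: if_splits)
  next
    case (Mov d a)
    then show ?thesis
      using c s represents_upd_reg[OF r, of d "\<rho> a"]
      by (auto intro!: single[of "M(addr d := \<rho> a)" _ _ _ "oper_code f ! 0"] split: if_splits)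
  next
    case (Add d a b)
    then show ?thesis
      using c s represents_upd_reg[OF r, of d "\<rho> a + \<rho> b"]
      by (auto intro!: single[of "M(addr d := \<rho> a + \<rho> b)" _ _ _ "oper_code f ! 0"] split: if_splits)
  next
    case (Sub d a b)
    then show ?thesis
      using c s represents_upd_reg[OF r, of d "\<rho> a - \<rho> b"]
      by (auto intro!: single[of "M(addr d := \<rho> a - \<rho> b)" _ _ _ "oper_code f ! 0"] split: if_splits)
  next
    case (Mul d a b)
    then show ?thesis
      using c s represents_upd_reg[OF r, of d "\<rho> a * \<rho> b"]
      by (auto intro!: single[of "M(addr d := \<rho> a * \<rho> b)" _ _ _ "oper_code f ! 0"] split: if_splits)
  next
    case (Quot d a b)
    then show ?thesis
      using c s represents_upd_reg[OF r, of d "\<rho> a div \<rho> b"]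
      by (auto intro!: single[of "M(addr d := \<rho> a div \<rho> b)" _ _ _ "oper_code f ! 0"] split: if_splits)
  next
    case (GetA d i)
    have i: "\<rho> i < cap" and s: "s = (\<rho>(d := A (\<rho> i)), A, B, ys, 5 + \<tau>)"
      using s GetA by (auto split: if_splits)
    let ?M = "M(4 := M 2 + 2 * \<rho> i)"
    have *: "steps P (2 + 1) (p, M, ys) = Some (p + length (oper_code f), ?M(addr d := A (\<rho> i)), ys)"
      unfolding ram_steps_add using array[of i 2] c GetA i represents_bases[OF r]
        represents_getA[OF r i] by auto
    show ?thesis
      unfolding s by (rule reachesI[OF *]) (use represents_upd_reg[OF r4] in simp_all)
  next
    case (GetB d i)
    have i: "\<rho> i < cap" and s: "s = (\<rho>(d := B (\<rho> i)), A, B, ys, 5 + \<tau>)"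
      using s GetB by (auto split: if_splits)
    let ?M = "M(4 := M 3 + 2 * \<rho> i)"
    have *: "steps P (2 + 1) (p, M, ys) = Some (p + length (oper_code f), ?M(addr d := B (\<rho> i)), ys)"
      unfolding ram_steps_add using array[of i 3] c GetB i represents_bases[OF r]
        represents_getB[OF r i] by auto
    show ?thesis
      unfolding s by (rule reachesI[OF *]) (use represents_upd_reg[OF r4] in simp_all)
  next
    case (PutA i a)
    have i: "\<rho> i < cap" and s: "s = (\<rho>, A(\<rho> i := \<rho> a), B, ys, 5 + \<tau>)"
      using s PutA by (auto split: if_splits)
    let ?M = "M(4 := M 2 + 2 * \<rho> i)"
    have *: "steps P (2 + 1) (p, M, ys) = Some (p + length (oper_code f), ?M(?M 2 + 2 * \<rho> i := \<rho> a), ys)"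
      unfolding ram_steps_add using array[of i 2] c PutA i represents_bases[OF r] by auto
    show ?thesis
      unfolding s by (rule reachesI[OF *]) (use represents_putA[OF r4 i] in simp_all)
  next
    case (PutB i a)
    have i: "\<rho> i < cap" and s: "s = (\<rho>, A, B(\<rho> i := \<rho> a), ys, 5 + \<tau>)"
      using s PutB by (auto split: if_splits)
    let ?M = "M(4 := M 3 + 2 * \<rho> i)"
    have *: "steps P (2 + 1) (p, M, ys) = Some (p + length (oper_code f), ?M(?M 3 + 2 * \<rho> i := \<rho> a), ys)"
      unfolding ram_steps_add using array[of i 3] c PutB i represents_bases[OF r] by auto
    show ?thesis
      unfolding s by (rule reachesI[OF *]) (use represents_putB[OF r4 i] in simp_all)
  next
    case Swap
    have *: "steps P 3 (p, M, ys) = Some (p + length (oper_code f), M(4 := M 2, 2 := M 3, 3 := M 2), ys)"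
      using c Swap by (simp add: ram_steps_3 ram_steps_2)
    show ?thesis
      using reachesI[OF *, of \<tau> "5 + \<tau>" \<rho> B A] represents_swap[OF r4, of "M 2"] s Swap by auto
  next
    case (Emit a)
    then show ?thesis
      using c s r by (auto intro!: single[of M _ _ _ "oper_code f ! 0"])
  qed
qed

lemma branch_code_correct:
  assumes r: "represents M \<rho> A B" and c: "code_at P p (branch_code q @ [JUMPZ 4 l])"
    and ok: "test_ok q \<rho>"
  obtains t M' where
    "steps P t (p, M, ys) =
       Some (if test_val q \<rho> then p + length (branch_code q) + 1 else l, M', ys)"
    "t \<le> 4" "represents M' \<rho> A B"
proof (cases q)
  case (Lt a b)
  note [simp] = addr_less_cells represents_reg[OF r] ram_step_def code_at_Cons code_at_Nil addr_reserved
  have "steps P 2 (p, M, ys) =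
      Some (if test_val q \<rho> then p + length (branch_code q) + 1 else l, M(4 := \<rho> b - \<rho> a), ys)"
    using c Lt by (simp add: ram_steps_2)
  then show thesis
    using that represents_upd_temp[OF r] by force
next
  case (Less a b)
  note [simp] = addr_less_cells represents_reg[OF r] ram_step_def code_at_Cons code_at_Nil addr_reserved
  have [simp]: "(2::nat) < 2 ^ w" using cells by linarith
  have [simp]: "0 < w" using cells by (cases w) simp_all
  define v where "v = three_way (x ! \<rho> b) (x ! \<rho> a)"
  have v: "v mod 2 ^ w = v" "0 < v - 1 \<longleftrightarrow> test_val q \<rho>"
    using Less by (auto simp: v_def three_way_def key_def)
  have "steps P 4 (p, M, ys) =
      Some (if test_val q \<rho> then p + length (branch_code q) + 1 else l, M(5 := 1, 4 := v - 1), ys)"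
    using c Less ok v by (auto simp: ram_steps_4 ram_steps_3 ram_steps_2 v_def[symmetric])
  then show thesis
    using that represents_upd_temp[OF represents_upd_temp[OF r]] by force
qed

text \<open>By induction on the derivation of \<open>exec\<close>, which is finite, so loops require
  no measure here. The clock only has to dominate the true number of steps.\<close>

theorem code_correct:
  assumes "exec c (\<rho>, A, B, ys, \<tau>) s'" "represents M \<rho> A B" "code_at P p (code p c)"
  shows "reaches P p M ys \<tau> (p + code_length c) s'"
  using assms
proof (induction c "(\<rho>, A, B, ys, \<tau>)" s' arbitrary: \<rho> A B ys \<tau> p M)
  case Skip
  then show ?case by (auto intro: reachesI[of _ 0])
next
  case (Op f s')
  then show ?case using oper_code_correct by simp
next
  case (Seq c s' d s'')
  obtain \<rho>1 A1 B1 ys1 \<tau>1 where s': "s' = (\<rho>1, A1, B1, ys1, \<tau>1)" by (cases s')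
  obtain \<rho>2 A2 B2 ys2 \<tau>2 where s'': "s'' = (\<rho>2, A2, B2, ys2, \<tau>2)" by (cases s'')
  have c: "code_at P p (code p c)" "code_at P (p + code_length c) (code (p + code_length c) d)"
    using Seq.prems by (simp_all add: code_at_append)
  obtain t M1 where 1: "steps P t (p, M, ys) = Some (p + code_length c, M1, ys1)"
    "\<tau> + t \<le> \<tau>1" "represents M1 \<rho>1 A1 B1"
    using Seq.hyps(2)[OF Seq.prems(1) c(1)] by (auto simp: reaches_def s')
  obtain u M2 where 2: "steps P u (p + code_length c, M1, ys1) =
      Some (p + code_length c + code_length d, M2, ys2)"
    "\<tau>1 + u \<le> \<tau>2" "represents M2 \<rho>2 A2 B2"
    using Seq.hyps(4)[OF s' 1(3) c(2)] by (auto simp: reaches_def s'')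
  have "steps P (t + u) (p, M, ys) = Some (p + code_length (c ;; d), M2, ys2)"
    unfolding ram_steps_add using 1 2 by (simp add: add.assoc)
  then show ?case
    unfolding s'' using 1 2 by (auto intro: reachesI)
next
  case (IfTrue q \<rho> c A B ys \<tau> s d)
  let ?l = "length (branch_code q)"
  let ?e = "p + ?l + 1 + code_length c"
  have c: "code_at P p (branch_code q @ [JUMPZ 4 (p + ?l + 2 + code_length c)])"
    "code_at P (p + ?l + 1) (code (p + ?l + 1) c)"
    "?e < length P" "P ! ?e = JUMP (p + code_length (IF q c d))"
    using IfTrue.prems(2) by (auto simp: code_at_append code_at_Cons code_at_Nil Let_def)
  obtain t M1 where 1: "steps P t (p, M, ys) = Some (p + ?l + 1, M1, ys)" "t \<le> 4"
    "represents M1 \<rho> A B"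
    using branch_code_correct[OF IfTrue.prems(1) c(1) IfTrue.hyps(1)] IfTrue.hyps(2) by metis
  obtain \<rho>' A' B' ys' \<tau>' u M2 where s: "s = (\<rho>', A', B', ys', \<tau>')"
    and 2: "steps P u (p + ?l + 1, M1, ys) = Some (?e, M2, ys')"
      "5 + \<tau> + u \<le> \<tau>'" "represents M2 \<rho>' A' B'"
    using IfTrue.hyps(4)[OF 1(3) c(2)] unfolding reaches_def by (auto split: prod.splits)
  \<comment> \<open>Test and branch take at most 4 steps; this closing jump uses up the fifth one
    charged for the test. The same accounting serves the jump back of a loop.\<close>
  have 3: "steps P 1 (?e, M2, ys') = Some (p + code_length (IF q c d), M2, ys')"
    using c(3,4) unfolding steps_1 by (simp only: ram_step_def fst_conv if_True exec_instr.simps)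
  have "steps P (t + u + 1) (p, M, ys) = Some (p + code_length (IF q c d), M2, ys')"
    unfolding ram_steps_add using 1 2 3 by simp
  then show ?case
    unfolding s by (rule reachesI) (use 1 2 in simp_all)
next
  case (IfFalse q \<rho> d A B ys \<tau> s c)
  let ?p = "p + length (branch_code q) + 2 + code_length c"
  have c: "code_at P p (branch_code q @ [JUMPZ 4 ?p])" "code_at P ?p (code ?p d)"
    using IfFalse.prems(2) by (auto simp: code_at_append code_at_Cons code_at_Nil Let_def)
  obtain t M1 where 1: "steps P t (p, M, ys) = Some (?p, M1, ys)" "t \<le> 4"
    "represents M1 \<rho> A B"
    using branch_code_correct[OF IfFalse.prems(1) c(1) IfFalse.hyps(1)] IfFalse.hyps(2) by metis
  obtain \<rho>' A' B' ys' \<tau>' u M2 where s: "s = (\<rho>', A', B', ys', \<tau>')"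
    and 2: "steps P u (?p, M1, ys) = Some (?p + code_length d, M2, ys')"
      "5 + \<tau> + u \<le> \<tau>'" "represents M2 \<rho>' A' B'"
    using IfFalse.hyps(4)[OF 1(3) c(2)] unfolding reaches_def by (auto split: prod.splits)
  have "steps P (t + u) (p, M, ys) = Some (p + code_length (IF q c d), M2, ys')"
    unfolding ram_steps_add using 1 2 by (simp add: algebra_simps)
  then show ?case
    unfolding s by (rule reachesI) (use 1 2 in simp_all)
next
  case (WhileTrue q \<rho> c A B ys \<tau> s s')
  let ?l = "length (branch_code q)"
  let ?e = "p + ?l + 1 + code_length c"
  have c: "code_at P p (branch_code q @ [JUMPZ 4 (p + ?l + 2 + code_length c)])"
    "code_at P (p + ?l + 1) (code (p + ?l + 1) c)" "?e < length P" "P ! ?e = JUMP p"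
    using WhileTrue.prems(2) by (auto simp: code_at_append code_at_Cons code_at_Nil Let_def)
  obtain t M1 where 1: "steps P t (p, M, ys) = Some (p + ?l + 1, M1, ys)" "t \<le> 4"
    "represents M1 \<rho> A B"
    using branch_code_correct[OF WhileTrue.prems(1) c(1) WhileTrue.hyps(1)] WhileTrue.hyps(2)
    by metis
  obtain \<rho>' A' B' ys' \<tau>' u M2 where s: "s = (\<rho>', A', B', ys', \<tau>')"
    and 2: "steps P u (p + ?l + 1, M1, ys) = Some (?e, M2, ys')"
      "5 + \<tau> + u \<le> \<tau>'" "represents M2 \<rho>' A' B'"
    using WhileTrue.hyps(4)[OF 1(3) c(2)] unfolding reaches_def by (auto split: prod.splits)
  have 3: "steps P 1 (?e, M2, ys') = Some (p, M2, ys')"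
    using c(3,4) unfolding steps_1 by (simp only: ram_step_def fst_conv if_True exec_instr.simps)
  obtain \<rho>'' A'' B'' ys'' \<tau>'' v M3 where s': "s' = (\<rho>'', A'', B'', ys'', \<tau>'')"
    and 4: "steps P v (p, M2, ys') = Some (p + code_length (WHILE q c), M3, ys'')"
      "\<tau>' + v \<le> \<tau>''" "represents M3 \<rho>'' A'' B''"
    using WhileTrue.hyps(6)[OF s 2(3) WhileTrue.prems(2)] unfolding reaches_def
    by (auto split: prod.splits)
  have "steps P (t + u + 1 + v) (p, M, ys) = Some (p + code_length (WHILE q c), M3, ys'')"
    unfolding ram_steps_add using 1 2 3 4 by simp
  then show ?case
    unfolding s' by (rule reachesI) (use 1 2 4 in simp_all)
next
  case (WhileFalse q \<rho> c A B ys \<tau>)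
  let ?p = "p + length (branch_code q) + 2 + code_length c"
  have c: "code_at P p (branch_code q @ [JUMPZ 4 ?p])"
    using WhileFalse.prems(2) by (auto simp: code_at_append code_at_Cons code_at_Nil Let_def)
  obtain t M1 where 1: "steps P t (p, M, ys) = Some (?p, M1, ys)" "t \<le> 4"
    "represents M1 \<rho> A B"
    using branch_code_correct[OF WhileFalse.prems(1) c WhileFalse.hyps(1)] WhileFalse.hyps(2)
    by metis
  then show ?case
    by (auto intro: reachesI simp: add.assoc)
qed

section \<open>Weakest preconditions\<close>

text \<open>The existential makes this total correctness: some execution terminates without failure,
  as \<open>code_correct\<close> demands of its premise. The equations below, used as simplification
  rules, reduce straight-line code to arithmetic side conditions.\<close>

definition wp :: "com \<Rightarrow> ((reg \<Rightarrow> nat) \<Rightarrow> (nat \<Rightarrow> nat) \<Rightarrow> (nat \<Rightarrow> nat) \<Rightarrow> nat list \<Rightarrow> nat \<Rightarrow> bool)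
    \<Rightarrow> (reg \<Rightarrow> nat) \<Rightarrow> (nat \<Rightarrow> nat) \<Rightarrow> (nat \<Rightarrow> nat) \<Rightarrow> nat list \<Rightarrow> nat \<Rightarrow> bool" where
  "wp c Q \<rho> A B ys \<tau> \<longleftrightarrow>
     (\<exists>\<rho>' A' B' ys' \<tau>'. exec c (\<rho>, A, B, ys, \<tau>) (\<rho>', A', B', ys', \<tau>') \<and> Q \<rho>' A' B' ys' \<tau>')"

lemma wp_mono:
  assumes "wp c Q \<rho> A B ys \<tau>"
    and "\<And>\<rho>' A' B' ys' \<tau>'. Q \<rho>' A' B' ys' \<tau>' \<Longrightarrow> Q' \<rho>' A' B' ys' \<tau>'"
  shows "wp c Q' \<rho> A B ys \<tau>"
  using assms unfolding wp_def by blast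

inductive_cases exec_SkipE: "exec SKIP s s'"
inductive_cases exec_OpE: "exec (OP f) s s'"
inductive_cases exec_SeqE: "exec (c ;; d) s s'"
inductive_cases exec_IfE: "exec (IF q c d) s s'"

lemma wp_Skip [simp]: "wp SKIP Q \<rho> A B ys \<tau> \<longleftrightarrow> Q \<rho> A B ys \<tau>"
  unfolding wp_def by (blast intro: exec.Skip elim: exec_SkipE)

lemma wp_Seq [simp]: "wp (c ;; d) Q \<rho> A B ys \<tau> \<longleftrightarrow> wp c (wp d Q) \<rho> A B ys \<tau>"
proof
  assume "wp (c ;; d) Q \<rho> A B ys \<tau>"
  then show "wp c (wp d Q) \<rho> A B ys \<tau>"
    unfolding wp_def by (metis exec_SeqE prod_cases5)
next
  assume "wp c (wp d Q) \<rho> A B ys \<tau>"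
  then show "wp (c ;; d) Q \<rho> A B ys \<tau>"
    unfolding wp_def by (metis exec.Seq)
qed

lemma wp_If [simp]:
  "wp (IF q c d) Q \<rho> A B ys \<tau> \<longleftrightarrow> test_ok q \<rho> \<and>
     (if test_val q \<rho> then wp c Q \<rho> A B ys (5 + \<tau>) else wp d Q \<rho> A B ys (5 + \<tau>))"
  proof (cases "test_val q \<rho>")
  case True
  then show ?thesis
    unfolding wp_def by simp (blast intro: exec.IfTrue elim: exec_IfE)
next
  case False
  then show ?thesis
    unfolding wp_def by simp (blast intro: exec.IfFalse elim: exec_IfE)
qed

lemma wp_Op:
  "wp (OP f) Q \<rho> A B ys \<tau> \<longleftrightarrow> (\<exists>\<rho>' A' B' ys' \<tau>'.
     oper_step f (\<rho>, A, B, ys, \<tau>) = Some (\<rho>', A', B', ys', \<tau>') \<and> Q \<rho>' A' B' ys' \<tau>')"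
  unfolding wp_def by (blast intro: exec.Op elim: exec_OpE)

lemma wp_opers [simp]:
  "wp (OP (Lit d v)) Q \<rho> A B ys \<tau> \<longleftrightarrow> v < 2 ^ w \<and> Q (\<rho>(d := v)) A B ys (5 + \<tau>)"
  "wp (OP (Mov d a)) Q \<rho> A B ys \<tau> \<longleftrightarrow> Q (\<rho>(d := \<rho> a)) A B ys (5 + \<tau>)"
  "wp (OP (Add d a b)) Q \<rho> A B ys \<tau> \<longleftrightarrow>
     \<rho> a + \<rho> b < 2 ^ w \<and> Q (\<rho>(d := \<rho> a + \<rho> b)) A B ys (5 + \<tau>)"
  "wp (OP (Sub d a b)) Q \<rho> A B ys \<tau> \<longleftrightarrow> Q (\<rho>(d := \<rho> a - \<rho> b)) A B ys (5 + \<tau>)"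
  "wp (OP (Mul d a b)) Q \<rho> A B ys \<tau> \<longleftrightarrow>
     \<rho> a * \<rho> b < 2 ^ w \<and> Q (\<rho>(d := \<rho> a * \<rho> b)) A B ys (5 + \<tau>)"
  "wp (OP (Quot d a b)) Q \<rho> A B ys \<tau> \<longleftrightarrow> Q (\<rho>(d := \<rho> a div \<rho> b)) A B ys (5 + \<tau>)"
  "wp (OP (GetA d i)) Q \<rho> A B ys \<tau> \<longleftrightarrow> \<rho> i < cap \<and> Q (\<rho>(d := A (\<rho> i))) A B ys (5 + \<tau>)"
  "wp (OP (GetB d i)) Q \<rho> A B ys \<tau> \<longleftrightarrow> \<rho> i < cap \<and> Q (\<rho>(d := B (\<rho> i))) A B ys (5 + \<tau>)"
  "wp (OP (PutA i a)) Q \<rho> A B ys \<tau> \<longleftrightarrow> \<rho> i < cap \<and> Q \<rho> (A(\<rho> i := \<rho> a)) B ys (5 + \<tau>)"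
  "wp (OP (PutB i a)) Q \<rho> A B ys \<tau> \<longleftrightarrow> \<rho> i < cap \<and> Q \<rho> A (B(\<rho> i := \<rho> a)) ys (5 + \<tau>)"
  "wp (OP Swap) Q \<rho> A B ys \<tau> \<longleftrightarrow> Q \<rho> B A ys (5 + \<tau>)"
  "wp (OP (Emit a)) Q \<rho> A B ys \<tau> \<longleftrightarrow> Q \<rho> A B (ys @ [\<rho> a]) (5 + \<tau>)"
  by (auto simp: wp_Op split: if_splits)

text \<open>The measure serves termination only. Running time is not read off from it but carried in
  the invariant, which sees the clock.\<close>

lemma wp_While:
  fixes \<mu> :: "(reg \<Rightarrow> nat) \<Rightarrow> nat"
  assumes "I \<rho> A B ys \<tau>"
    and ok: "\<And>\<rho> A B ys \<tau>. I \<rho> A B ys \<tau> \<Longrightarrow> test_ok q \<rho>"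
    and body: "\<And>\<rho> A B ys \<tau>. I \<rho> A B ys \<tau> \<Longrightarrow> test_val q \<rho> \<Longrightarrow>
      wp c (\<lambda>\<rho>' A' B' ys' \<tau>'. I \<rho>' A' B' ys' \<tau>' \<and> \<mu> \<rho>' < \<mu> \<rho>) \<rho> A B ys (5 + \<tau>)"
    and exit: "\<And>\<rho> A B ys \<tau>. I \<rho> A B ys \<tau> \<Longrightarrow> \<not> test_val q \<rho> \<Longrightarrow> Q \<rho> A B ys (5 + \<tau>)"
  shows "wp (WHILE q c) Q \<rho> A B ys \<tau>"
  using assms(1)
proof (induction "\<mu> \<rho>" arbitrary: \<rho> A B ys \<tau> rule: less_induct)
  case less
  show ?case
  proof (cases "test_val q \<rho>")
    case True
    then obtain \<rho>' A' B' ys' \<tau>' where e: "exec c (\<rho>, A, B, ys, 5 + \<tau>) (\<rho>', A', B', ys', \<tau>')"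
      and i: "I \<rho>' A' B' ys' \<tau>'" "\<mu> \<rho>' < \<mu> \<rho>"
      using body[OF less.prems] unfolding wp_def by blast
    show ?thesis
      using less.hyps[OF i(2,1)] exec.WhileTrue[OF ok[OF less.prems] True e] unfolding wp_def by blast
  next
    case False
    show ?thesis
      using exit[OF less.prems False] exec.WhileFalse[OF ok[OF less.prems] False]
      unfolding wp_def by blast
  qed
qed

end

section \<open>Binary search and merge sort\<close>

text \<open>
  The array has length \<open>2\<^sup>q\<^sup>+\<^sup>1\<close>, so the step width can simply be halved.  If the key at \<open>RP\<close> occurs,
  the result is its first position, which serves as the index of its counter.
\<close>

definition lookup :: com where
  "lookup = OP (Lit RPos 0) ;; OP (Mov RStep RB) ;; OP (Lit RY 2) ;;
     WHILE (Lt RZero RStep)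
       (OP (Add RX RPos RStep) ;; OP (Sub RX RX ROne) ;; OP (GetA RX RX) ;;
        IF (Less RX RP) (OP (Add RPos RPos RStep)) SKIP ;;
        OP (Quot RStep RStep RY))"

text \<open>The power is unrolled: \<open>k\<close> is a constant of the program, so the code length
  depends on \<open>k\<close> but not on the input.\<close>

primrec multiply :: "nat \<Rightarrow> com" where
  "multiply 0 = SKIP"
| "multiply (Suc k) = OP (Mul RG RG RY) ;; multiply k"

definition power_of :: "nat \<Rightarrow> com" where
  "power_of k = IF (Lt RZero RY) (OP (Lit RG 1) ;; multiply k) (OP (Lit RG 0))"

text \<open>For \<open>k = 0\<close> this differs from \<open>f ^ k\<close> at \<open>f = 0\<close>: an absent symbol contributes nothing to \<open>F\<^sub>0\<close>.\<close>

definition contrib :: "nat \<Rightarrow> nat \<Rightarrow> nat" where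
  "contrib k f = (if f = 0 then 0 else f ^ k)"

definition take_left :: com where
  "take_left = OP (GetA RX RI) ;; OP (PutB RO RX) ;; OP (Add RI RI ROne) ;; OP (Add RO RO ROne)"

definition take_right :: com where
  "take_right = OP (GetA RX RJ) ;; OP (PutB RO RX) ;; OP (Add RJ RJ ROne) ;; OP (Add RO RO ROne)"

text \<open>The merged run occupies in \<open>B\<close> the range that the two runs occupy in
  \<open>A\<close>, so the output index reaches \<open>RJE\<close> exactly when both runs are
  exhausted.\<close>

definition merge_runs :: com where
  "merge_runs = WHILE (Lt RO RJE)
     (IF (Lt RI RIE)
       (IF (Lt RJ RJE)
         (OP (GetA RX RI) ;; OP (GetA RY RJ) ;; IF (Less RY RX) take_right take_left)
         take_left)
       take_right)"

text \<open>\<open>merge_runs\<close> leaves \<open>RO\<close> at the end of the pair just merged,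
  which is the start of the next one; so \<open>RO\<close> also drives the outer loop.\<close>

definition merge_pass :: com where
  "merge_pass = OP (Lit RO 0) ;;
     WHILE (Lt RO RNN)
       (OP (Mov RI RO) ;; OP (Add RIE RI RH) ;; OP (Mov RJ RIE) ;; OP (Add RJE RJ RH) ;;
        merge_runs)"

definition merge_sort :: com where
  "merge_sort = OP (Mov RH ROne) ;;
     WHILE (Lt RH RNN) (merge_pass ;; OP Swap ;; OP (Add RH RH RH))"

text \<open>In the bound on the word length, the power of \<open>n + 1\<close> dominates every
  \<open>F_k\<close> of a window and every power of a frequency; the factor 256 makes room for index
  arithmetic, whose values are small multiples of \<open>n\<close> because
  \<open>2 ^ q <= n\<close>.\<close>

locale window_machine = machine w cap x for w cap and x :: "'a::linorder list" +
  fixes n k q :: nat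
  assumes n: "1 \<le> n" and length_x: "length x = 2 * n - 1"
    and room: "2 * 2 ^ q \<le> cap" and block_le: "2 ^ q \<le> n"
    and word: "256 * (n + 1) ^ (k + 2) \<le> 2 ^ w"
begin

definition constants :: "(reg \<Rightarrow> nat) \<Rightarrow> bool" where
  "constants \<rho> \<longleftrightarrow> \<rho> RN = n \<and> \<rho> RZero = 0 \<and> \<rho> ROne = 1 \<and> \<rho> RB = 2 ^ q \<and> \<rho> RNN = 2 * 2 ^ q \<and>
     \<rho> RE = 2 * n - 1 \<and> \<rho> REM = 2 * n - 2"

lemma small: "v < 256 * (n + 1) \<Longrightarrow> v < 2 ^ w"
proof -
  assume v: "v < 256 * (n + 1)"
  have "(n + 1) ^ 1 \<le> (n + 1) ^ (k + 2)" by (intro power_increasing) auto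
  then show ?thesis using v word by simp
qed

definition is_first :: "(nat \<Rightarrow> nat) \<Rightarrow> 'a \<Rightarrow> nat \<Rightarrow> bool" where
  "is_first A v f \<longleftrightarrow> f < 2 * 2 ^ q \<and> key (A f) = v \<and> (\<forall>i<f. key (A i) \<noteq> v)"

definition sorted_on_range :: "(nat \<Rightarrow> nat) \<Rightarrow> nat \<Rightarrow> nat \<Rightarrow> bool" where
  "sorted_on_range A l u \<longleftrightarrow> (\<forall>i j. l \<le> i \<longrightarrow> i \<le> j \<longrightarrow> j < u \<longrightarrow> key (A i) \<le> key (A j))"

definition positions :: "(nat \<Rightarrow> nat) \<Rightarrow> bool" where
  "positions A \<longleftrightarrow> (\<forall>i < 2 * 2 ^ q. A i < length x)"

text \<open>The range of length \<open>2 ^ j\<close> starting at \<open>RPos\<close> always contains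
  the first occurrence, if there is one, and is halved in each of the \<open>q + 1\<close> rounds.
  For an absent key only a valid index is promised, so a caller that cannot exclude this case must
  compare again.\<close>

lemma wp_lookup:
  assumes c: "constants \<rho>" and p: "\<rho> RP < length x" and A: "positions A"
    and s: "sorted_on_range A 0 (2 * 2 ^ q)"
  shows "wp lookup (\<lambda>\<rho>' A' B' ys' \<tau>'. A' = A \<and> B' = B \<and> ys' = ys \<and> \<tau>' \<le> \<tau> + 60 + 40 * q \<and>
      (\<forall>r. r \<notin> {RPos, RStep, RX, RY} \<longrightarrow> \<rho>' r = \<rho> r) \<and> \<rho>' RPos < 2 * 2 ^ q \<and>
      (\<forall>f. is_first A (key (\<rho> RP)) f \<longrightarrow> \<rho>' RPos = f)) \<rho> A B ys \<tau>"
proof -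
  let ?v = "key (\<rho> RP)"
  \<comment> \<open>The step width is \<open>2 ^ j div 2\<close>, which is 0 at
    \<open>j = 0\<close>; this is how the loop test recognises a range of length 1. A round costs at
    most 40.\<close>
  define I where "I \<rho>' A' B' ys' \<tau>' \<longleftrightarrow> A' = A \<and> B' = B \<and> ys' = ys \<and>
     (\<forall>r. r \<notin> {RPos, RStep, RX, RY} \<longrightarrow> \<rho>' r = \<rho> r) \<and> \<rho>' RY = 2 \<and>
     (\<exists>j \<le> q + 1. \<rho>' RStep = 2 ^ j div 2 \<and> \<rho>' RPos + 2 ^ j \<le> 2 * 2 ^ q \<and>
       \<tau>' + 40 * j \<le> \<tau> + 55 + 40 * q \<and>
       (\<forall>f. is_first A ?v f \<longrightarrow> \<rho>' RPos \<le> f \<and> f < \<rho>' RPos + 2 ^ j))"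
    for \<rho>' A' B' ys' and \<tau>' :: nat
  have zero: "\<rho> RZero = 0" and one: "\<rho> ROne = 1" and blk: "\<rho> RB = 2 ^ q"
    using c by (auto simp: constants_def)
  have half_zero: "j = 0" if "(2::nat) ^ j div 2 = 0" for j
    using that by (cases j) simp_all
  have start: "I (\<rho>(RPos := 0, RStep := 2 ^ q, RY := 2)) A B ys (15 + \<tau>)"
    unfolding I_def by (auto intro!: exI[of _ "q + 1"] simp: is_first_def)
  have body: "wp (OP (Add RX RPos RStep) ;; OP (Sub RX RX ROne) ;; OP (GetA RX RX) ;;
        IF (Less RX RP) (OP (Add RPos RPos RStep)) SKIP ;; OP (Quot RStep RStep RY))
      (\<lambda>\<rho>'' A'' B'' ys'' \<tau>''. I \<rho>'' A'' B'' ys'' \<tau>'' \<and> \<rho>'' RStep < \<rho>' RStep) \<rho>' A' B' ys' (5 + \<tau>')"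
    if I: "I \<rho>' A' B' ys' \<tau>'" and t: "test_val (Lt RZero RStep) \<rho>'" for \<rho>' A' B' ys' \<tau>'
  proof -
    have [simp]: "A' = A" "B' = B" "ys' = ys" and fr: "\<And>r. r \<notin> {RPos, RStep, RX, RY} \<Longrightarrow> \<rho>' r = \<rho> r"
      and y: "\<rho>' RY = 2" using I by (auto simp: I_def)
    have regs: "\<rho>' RZero = 0" "\<rho>' ROne = 1" "\<rho>' RP = \<rho> RP"
      using fr zero one by auto
    obtain j where j: "j \<le> q + 1" "\<rho>' RStep = 2 ^ j div 2" "\<rho>' RPos + 2 ^ j \<le> 2 * 2 ^ q"
       "\<tau>' + 40 * j \<le> \<tau> + 55 + 40 * q"
       "\<And>f. is_first A ?v f \<Longrightarrow> \<rho>' RPos \<le> f \<and> f < \<rho>' RPos + 2 ^ j"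
      using I by (auto simp: I_def)
    obtain i where i: "j = Suc i" using t j(2) regs by (cases j) auto
    have st: "\<rho>' RStep = 2 ^ i" using j i by simp
    \<comment> \<open>The last index of the lower half. If its key is too small, so are all keys in
      that half; otherwise the first occurrence cannot lie beyond it.\<close>
    define m where "m = \<rho>' RPos + 2 ^ i - Suc 0"
    have m: "m < 2 * 2 ^ q" "m < cap" "\<rho>' RPos + 2 ^ i < 2 ^ w"
    proof -
      have "0 < (2::nat) ^ i" by simp
      moreover have "\<rho>' RPos + 2 * 2 ^ i \<le> 2 * 2 ^ q" using j(3) i by simp
      ultimately have "\<rho>' RPos + 2 ^ i < 2 * 2 ^ q" by linarith
      then show "m < 2 * 2 ^ q" "m < cap" "\<rho>' RPos + 2 ^ i < 2 ^ w"
        using room block_le unfolding m_def by (auto intro!: small)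
    qed
    have mx: "A m < length x" using A m by (auto simp: positions_def)
    have up: "\<rho>' RPos + 2 ^ i \<le> f" if "is_first A ?v f" "key (A m) < ?v" for f
    proof (rule ccontr)
      assume "\<not> ?thesis"
      then have "f \<le> m" by (simp add: m_def)
      then have "key (A f) \<le> key (A m)" using s m by (auto simp: sorted_on_range_def)
      then show False using that by (auto simp: is_first_def)
    qed
    have down: "f < \<rho>' RPos + 2 ^ i" if f: "is_first A ?v f" and "\<not> key (A m) < ?v" for f
    proof (rule ccontr)
      assume "\<not> ?thesis"
      then have "m < f" by (simp add: m_def) (metis One_nat_def Suc_pred add_gr_0 not_less_eq zero_less_numeral zero_less_power)
      moreover have "key (A m) \<le> key (A f)"
        using s f \<open>m < f\<close> unfolding sorted_on_range_def is_first_def by (meson le0 less_imp_le)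
      ultimately show False using that by (auto simp: is_first_def)
    qed
    have I1: "I (\<rho>'(RX := A m, RPos := \<rho>' RPos + 2 ^ i, RStep := 2 ^ i div 2)) A B ys (35 + \<tau>')"
      if "key (A m) < ?v"
      unfolding I_def using fr y j i up[OF _ that] by (auto intro!: exI[of _ i] simp: mult_2 add.assoc)
    have I2: "I (\<rho>'(RX := A m, RStep := 2 ^ i div 2)) A B ys (30 + \<tau>')"
      if "\<not> key (A m) < ?v"
      unfolding I_def using fr y j i down[OF _ that] by (auto intro!: exI[of _ i])
    show ?thesis
      using m mx p I1 I2 by (auto simp: st regs y m_def[symmetric])
  qed
  show ?thesis
    unfolding lookup_def
    apply (simp add: blk small)
    apply (rule wp_While[where I = I and \<mu> = "\<lambda>\<rho>. \<rho> RStep"])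
       apply (rule start)
      apply simp
     apply (erule (1) body)
    apply (auto simp: I_def zero dest!: half_zero)
    done
qed

text \<open>With a base of at least 1 the partial products never exceed the final one, so a single
  bound on the result excludes overflow throughout.\<close>

lemma wp_multiply:
  assumes "1 \<le> \<rho> RY" "\<rho> RG * \<rho> RY ^ j < 2 ^ w" "Q (\<rho>(RG := \<rho> RG * \<rho> RY ^ j)) A B ys (\<tau> + 5 * j)"
  shows "wp (multiply j) Q \<rho> A B ys \<tau>"
  using assms
proof (induction j arbitrary: \<rho> \<tau>)
  case (Suc j)
  have "\<rho> RG * \<rho> RY * 1 \<le> \<rho> RG * \<rho> RY * \<rho> RY ^ j"
    using Suc.prems(1) by (intro mult_left_mono) auto
  then have "\<rho> RG * \<rho> RY < 2 ^ w" using Suc.prems(2)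
    by (metis le_less_trans mult.assoc mult.right_neutral power_Suc)
  moreover have "wp (multiply j) Q (\<rho>(RG := \<rho> RG * \<rho> RY)) A B ys (5 + \<tau>)"
    by (rule Suc.IH) (use Suc.prems in \<open>simp_all add: mult.assoc add_ac fun_upd_other fun_upd_same del: fun_upd_apply\<close>)
  ultimately show ?case by simp
qed simp

lemma power_le_word: "f \<le> n \<Longrightarrow> f ^ k < 2 ^ w"
proof -
  assume "f \<le> n"
  then have "f ^ k \<le> (n + 1) ^ k" by (intro power_mono) auto
  also have "\<dots> \<le> (n + 1) ^ (k + 2)" by (intro power_increasing) auto
  also have "\<dots> < 256 * (n + 1) ^ (k + 2)" by simp
  finally show ?thesis using word by simp
qed

text \<open>The two branches take different time, so the continuation is required for every clock
  value up to the larger one.\<close>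

lemma wp_power_of:
  assumes "\<rho> RZero = 0" "\<rho> RY \<le> n" 
    "\<And>\<tau>'. \<tau>' \<le> \<tau> + 10 + 5 * k \<Longrightarrow> Q (\<rho>(RG := contrib k (\<rho> RY))) A B ys \<tau>'"
  shows "wp (power_of k) Q \<rho> A B ys \<tau>"
  using assms power_le_word[of "\<rho> RY"] small[of 1] small[of 0]
  by (auto simp: power_of_def contrib_def intro!: wp_multiply)


text \<open>\<open>i\<close> and \<open>j\<close> are the next unread indices of the two runs and
  \<open>p\<close> is the next index to be written. Every written key is at most every unread one,
  which keeps the output sorted when it grows. Output and input are related as sets only, since
  later phases ask merely which positions occur.\<close>

definition merge_inv :: "nat \<Rightarrow> nat \<Rightarrow> (nat \<Rightarrow> nat) \<Rightarrow> (nat \<Rightarrow> nat) \<Rightarrow> nat \<Rightarrow> nat \<Rightarrow> nat \<Rightarrow> bool" where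
  "merge_inv l h A B i j p \<longleftrightarrow> l \<le> i \<and> i \<le> l + h \<and> l + h \<le> j \<and> j \<le> l + 2 * h \<and>
     p + (l + h) = i + j \<and> sorted_on_range B l p \<and>
     (\<forall>c d. l \<le> c \<longrightarrow> c < p \<longrightarrow> i \<le> d \<and> d < l + h \<or> j \<le> d \<and> d < l + 2 * h \<longrightarrow> key (B c) \<le> key (A d)) \<and>
     B ` {l..<p} = A ` ({l..<i} \<union> {l + h..<j})"

text \<open>The last hypothesis covers two situations: the comparison of the two heads, and a right
  run that is exhausted, where it holds vacuously. \<open>merge_inv_right\<close> is the mirror
  image.\<close>

lemma merge_inv_left:
  assumes "merge_inv l h A B i j p" "i < l + h" "sorted_on_range A l (l + h)"
    "\<And>d. j \<le> d \<Longrightarrow> d < l + 2 * h \<Longrightarrow> key (A i) \<le> key (A d)"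
  shows "merge_inv l h A (B(p := A i)) (Suc i) j (Suc p)"
proof -
  have 1: "{l..<Suc p} = insert p {l..<p}" "{l..<Suc i} = insert i {l..<i}"
    using assms(1,2) by (auto simp: merge_inv_def)
  have 2: "(B(p := A i)) ` {l..<p} = B ` {l..<p}" by auto
  have "(B(p := A i)) ` {l..<Suc p} = A ` ({l..<Suc i} \<union> {l + h..<j})"
    using assms(1) unfolding 1 by (auto simp: merge_inv_def 2 image_insert simp del: fun_upd_apply) auto
  then show ?thesis
    using assms unfolding merge_inv_def sorted_on_range_def by (auto simp: less_Suc_eq)
qed

lemma merge_inv_right:
  assumes "merge_inv l h A B i j p" "j < l + 2 * h" "sorted_on_range A (l + h) (l + 2 * h)"
    "\<And>d. i \<le> d \<Longrightarrow> d < l + h \<Longrightarrow> key (A j) \<le> key (A d)"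
  shows "merge_inv l h A (B(p := A j)) i (Suc j) (Suc p)"
proof -
  have 1: "{l..<Suc p} = insert p {l..<p}" "{l + h..<Suc j} = insert j {l + h..<j}"
    using assms(1,2) by (auto simp: merge_inv_def)
  have 2: "(B(p := A j)) ` {l..<p} = B ` {l..<p}" by auto
  have "(B(p := A j)) ` {l..<Suc p} = A ` ({l..<i} \<union> {l + h..<Suc j})"
    using assms(1) unfolding 1 by (auto simp: merge_inv_def 2 image_insert simp del: fun_upd_apply) auto
  then show ?thesis
    using assms unfolding merge_inv_def sorted_on_range_def by (auto simp: less_Suc_eq)
qed


lemma wp_merge_runs:
  assumes one: "\<rho> ROne = 1" and A: "positions A"
    and regs: "\<rho> RO = l" "\<rho> RI = l" "\<rho> RIE = l + h" "\<rho> RJ = l + h" "\<rho> RJE = l + 2 * h"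
    and le: "l + 2 * h \<le> 2 * 2 ^ q"
    and s: "sorted_on_range A l (l + h)" "sorted_on_range A (l + h) (l + 2 * h)"
  shows "wp merge_runs (\<lambda>\<rho>' A' B' ys' \<tau>'. A' = A \<and> ys' = ys \<and> \<tau>' \<le> \<tau> + 5 + 100 * h \<and>
      (\<forall>r. r \<notin> {RO, RI, RJ, RX, RY} \<longrightarrow> \<rho>' r = \<rho> r) \<and> \<rho>' RO = l + 2 * h \<and>
      (\<forall>i<l. B' i = B i) \<and> sorted_on_range B' l (l + 2 * h) \<and>
      B' ` {l..<l + 2 * h} = A ` {l..<l + 2 * h}) \<rho> A B ys \<tau>"
proof -
  \<comment> \<open>Fifty time units per written entry; \<open>50 * l\<close> stands on the left to
    avoid truncated subtraction.\<close>
  define I where "I \<rho>' A' B' ys' \<tau>' \<longleftrightarrow> A' = A \<and> ys' = ys \<and> \<tau>' + 50 * l \<le> \<tau> + 50 * \<rho>' RO \<and>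
     (\<forall>r. r \<notin> {RO, RI, RJ, RX, RY} \<longrightarrow> \<rho>' r = \<rho> r) \<and> (\<forall>i<l. B' i = B i) \<and>
     merge_inv l h A B' (\<rho>' RI) (\<rho>' RJ) (\<rho>' RO)"
    for \<rho>' A' B' ys' and \<tau>' :: nat
  have start: "I \<rho> A B ys \<tau>"
    by (auto simp: I_def merge_inv_def sorted_on_range_def regs)
  have body: "wp (IF (Lt RI RIE)
       (IF (Lt RJ RJE)
         (OP (GetA RX RI) ;; OP (GetA RY RJ) ;; IF (Less RY RX) take_right take_left)
         take_left)
       take_right)
      (\<lambda>\<rho>'' A'' B'' ys'' \<tau>''. I \<rho>'' A'' B'' ys'' \<tau>'' \<and> l + 2 * h - \<rho>'' RO < l + 2 * h - \<rho>' RO)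
      \<rho>' A' B' ys' (5 + \<tau>')"
    if I: "I \<rho>' A' B' ys' \<tau>'" and t: "test_val (Lt RO RJE) \<rho>'" for \<rho>' A' B' ys' \<tau>'
  proof -
    let ?i = "\<rho>' RI" and ?j = "\<rho>' RJ" and ?p = "\<rho>' RO"
    have [simp]: "A' = A" "ys' = ys" and fr: "\<And>r. r \<notin> {RO, RI, RJ, RX, RY} \<Longrightarrow> \<rho>' r = \<rho> r"
      and time: "\<tau>' + 50 * l \<le> \<tau> + 50 * ?p" and keep: "\<forall>i<l. B' i = B i"
      and inv: "merge_inv l h A B' ?i ?j ?p"
      using I by (auto simp: I_def)
    have r: "\<rho>' ROne = 1" "\<rho>' RIE = l + h" "\<rho>' RJE = l + 2 * h"
      using fr regs one by auto
    have p: "?p < l + 2 * h" "l \<le> ?p" "?i \<le> l + h" "?j \<le> l + 2 * h" "?p + (l + h) = ?i + ?j" "l \<le> ?i" "l + h \<le> ?j"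
      using t inv r by (auto simp: merge_inv_def)
    have bounds: "?p < cap" "?p + 1 < 2 ^ w" "?i + 1 < 2 ^ w" "?j + 1 < 2 ^ w"
      using p le room block_le by (auto intro!: small)
    \<comment> \<open>Arbitrary contents of \<open>RX\<close> and \<open>RY\<close> let this serve
      both the branch that has just loaded the two heads and the branch that has not.\<close>
    have left: "wp take_left (\<lambda>\<rho>'' A'' B'' ys'' \<tau>''. I \<rho>'' A'' B'' ys'' \<tau>'' \<and>
         l + 2 * h - \<rho>'' RO < l + 2 * h - \<rho>' RO) (\<rho>'(RX := a, RY := b)) A B' ys t"
      if i: "?i < l + h" and t: "t + 20 \<le> \<tau>' + 50"
        and m: "\<And>d. ?j \<le> d \<Longrightarrow> d < l + 2 * h \<Longrightarrow> key (A ?i) \<le> key (A d)" for a b t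
    proof -
      have "I (\<rho>'(RX := A ?i, RY := b, RI := Suc ?i, RO := Suc ?p)) A (B'(?p := A ?i)) ys (20 + t)"
        unfolding I_def using merge_inv_left[OF inv i s(1) m] time t fr keep p by auto
      moreover have "\<rho>'(RX := A ?i, RY := b, RI := Suc ?i, RO := Suc ?p) =
          \<rho>'(RY := b, RX := A ?i, RI := Suc ?i, RO := Suc ?p)" by auto
      ultimately show ?thesis
        using bounds p i le room by (auto simp: take_left_def r intro!: diff_less_mono2)
    qed
    have right: "wp take_right (\<lambda>\<rho>'' A'' B'' ys'' \<tau>''. I \<rho>'' A'' B'' ys'' \<tau>'' \<and>
         l + 2 * h - \<rho>'' RO < l + 2 * h - \<rho>' RO) (\<rho>'(RX := a, RY := b)) A B' ys t"
      if j: "?j < l + 2 * h" and t: "t + 20 \<le> \<tau>' + 50"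
        and m: "\<And>d. ?i \<le> d \<Longrightarrow> d < l + h \<Longrightarrow> key (A ?j) \<le> key (A d)" for a b t
    proof -
      have "I (\<rho>'(RX := A ?j, RY := b, RJ := Suc ?j, RO := Suc ?p)) A (B'(?p := A ?j)) ys (20 + t)"
        unfolding I_def using merge_inv_right[OF inv j s(2) m] time t fr keep p by auto
      moreover have "\<rho>'(RX := A ?j, RY := b, RJ := Suc ?j, RO := Suc ?p) =
          \<rho>'(RY := b, RX := A ?j, RJ := Suc ?j, RO := Suc ?p)" by auto
      ultimately show ?thesis
        using bounds p j le room by (auto simp: take_right_def r intro!: diff_less_mono2)
    qed
    have same: "\<rho>'(RX := \<rho>' RX, RY := \<rho>' RY) = \<rho>'" by auto
    consider "?i \<ge> l + h" | "?i < l + h" "?j \<ge> l + 2 * h"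
      | "?i < l + h" "?j < l + 2 * h" by linarith
    then show ?thesis
    proof cases
      case 1
      then have "?j < l + 2 * h" using p by auto
      then show ?thesis
        using 1 right[of "10 + \<tau>'" "\<rho>' RX" "\<rho>' RY"] by (simp add: r same)
    next
      case 2
      then show ?thesis
        using left[of "15 + \<tau>'" "\<rho>' RX" "\<rho>' RY"] by (simp add: r same)
    next
      case 3
      have x: "A ?i < length x" "A ?j < length x" "?i < cap" "?j < cap"
        using 3 A le room by (auto simp: positions_def)
      have l: "key (A ?i) \<le> key (A d)" if "?i \<le> d" "d < l + h" for d
        using s(1) p that by (auto simp: sorted_on_range_def)
      have r': "key (A ?j) \<le> key (A d)" if "?j \<le> d" "d < l + 2 * h" for d
        using s(2) p that by (auto simp: sorted_on_range_def)
      show ?thesis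
      proof (cases "key (A ?j) < key (A ?i)")
        case True
        then show ?thesis
          using 3 x right[of "30 + \<tau>'" "A ?i" "A ?j"] l by (fastforce simp: r)
      next
        case False
        then show ?thesis
          using 3 x left[of "30 + \<tau>'" "A ?i" "A ?j"] r' by (fastforce simp: r)
      qed
    qed
  qed
  show ?thesis
    unfolding merge_runs_def
  proof (rule wp_While[where I = I and \<mu> = "\<lambda>\<rho>. l + 2 * h - \<rho> RO"])
    show "I \<rho> A B ys \<tau>" by (rule start)
  next
    fix \<rho>' A' B' ys' \<tau>'
    assume I: "I \<rho>' A' B' ys' \<tau>'" and t: "\<not> test_val (Lt RO RJE) \<rho>'"
    have e: "\<rho>' RJE = l + 2 * h" using I regs by (auto simp: I_def)
    have inv: "merge_inv l h A B' (\<rho>' RI) (\<rho>' RJ) (\<rho>' RO)" using I by (simp add: I_def)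
    have "\<rho>' RI = l + h" "\<rho>' RJ = l + 2 * h" "\<rho>' RO = l + 2 * h"
      using inv t e by (auto simp: merge_inv_def)
    moreover have "{l..<l + h} \<union> {l + h..<l + 2 * h} = {l..<l + 2 * h}" by auto
    ultimately show "A' = A \<and> ys' = ys \<and> 5 + \<tau>' \<le> \<tau> + 5 + 100 * h \<and>
      (\<forall>r. r \<notin> {RO, RI, RJ, RX, RY} \<longrightarrow> \<rho>' r = \<rho> r) \<and> \<rho>' RO = l + 2 * h \<and>
      (\<forall>i<l. B' i = B i) \<and> sorted_on_range B' l (l + 2 * h) \<and>
      B' ` {l..<l + 2 * h} = A ` {l..<l + 2 * h}"
      using I inv by (auto simp: I_def merge_inv_def)
  qed (simp, erule (1) body)
qed

definition sorted_runs :: "nat \<Rightarrow> (nat \<Rightarrow> nat) \<Rightarrow> nat \<Rightarrow> bool" where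
  "sorted_runs h A u \<longleftrightarrow> (\<forall>c. Suc c * h \<le> u \<longrightarrow> sorted_on_range A (c * h) (Suc c * h))"

text \<open>\<open>m\<close> is the number of pairs of runs. As \<open>2 * h\<close> divides the
  array length, every pair is complete and no shorter run remains at the end.\<close>

lemma wp_merge_pass:
  assumes c: "constants \<rho>" and A: "positions A" and h: "\<rho> RH = h" "1 \<le> h"
    and d: "2 * h * m = 2 * 2 ^ q" and s: "sorted_runs h A (2 * 2 ^ q)"
  shows "wp merge_pass (\<lambda>\<rho>' A' B' ys' \<tau>'. A' = A \<and> ys' = ys \<and> \<tau>' \<le> \<tau> + 10 + 130 * 2 ^ q \<and>
      (\<forall>r. r \<notin> {RO, RI, RIE, RJ, RJE, RX, RY} \<longrightarrow> \<rho>' r = \<rho> r) \<and>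
      sorted_runs (2 * h) B' (2 * 2 ^ q) \<and>
      B' ` {..<2 * 2 ^ q} = A ` {..<2 * 2 ^ q}) \<rho> A B ys \<tau>"
proof -
  \<comment> \<open>A pair costs at most \<open>30 + 100 * h\<close>, which \<open>1 <= h\<close>
    bounds by \<open>65\<close> per entry.\<close>
  define I where "I \<rho>' A' B' ys' \<tau>' \<longleftrightarrow> A' = A \<and> ys' = ys \<and> \<tau>' \<le> \<tau> + 5 + 65 * \<rho>' RO \<and>
     (\<forall>r. r \<notin> {RO, RI, RIE, RJ, RJE, RX, RY} \<longrightarrow> \<rho>' r = \<rho> r) \<and>
     (\<exists>c\<le>m. \<rho>' RO = 2 * h * c) \<and> sorted_runs (2 * h) B' (\<rho>' RO) \<and>
     B' ` {..<\<rho>' RO} = A ` {..<\<rho>' RO}"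
    for \<rho>' A' B' ys' and \<tau>' :: nat
  show ?thesis
    unfolding merge_pass_def wp_Seq wp_opers
  proof (rule conjI[OF _ wp_While[where I = I and \<mu> = "\<lambda>\<rho>. 2 * 2 ^ q - \<rho> RO"]])
    show "I (\<rho>(RO := 0)) A B ys (5 + \<tau>)"
      using h by (auto simp: I_def sorted_runs_def)
  next
    fix \<rho>' A' B' ys' \<tau>'
    assume I: "I \<rho>' A' B' ys' \<tau>'" and t: "test_val (Lt RO RNN) \<rho>'"
    let ?l = "\<rho>' RO"
    have [simp]: "A' = A" "ys' = ys"
      and fr: "\<And>r. r \<notin> {RO, RI, RIE, RJ, RJE, RX, RY} \<Longrightarrow> \<rho>' r = \<rho> r"
      and time: "\<tau>' \<le> \<tau> + 5 + 65 * ?l" and runs: "sorted_runs (2 * h) B' ?l"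
      and im: "B' ` {..<?l} = A ` {..<?l}" using I by (auto simp: I_def)
    obtain c where cm: "c \<le> m" and l: "?l = 2 * h * c" using I by (auto simp: I_def)
    have r: "\<rho>' ROne = 1" "\<rho>' RH = h" "\<rho>' RNN = 2 * 2 ^ q"
      using fr c h by (auto simp: constants_def)
    have "?l < 2 * 2 ^ q" using t r by simp
    then have "2 * h * c < 2 * h * m" unfolding l d .
    then have "Suc c \<le> m" by simp
    then have le: "?l + 2 * h \<le> 2 * 2 ^ q"
      using mult_le_mono2[of "Suc c" m "2 * h"] d l by simp
    have s12: "sorted_on_range A ?l (?l + h)" "sorted_on_range A (?l + h) (?l + 2 * h)"
      using s[unfolded sorted_runs_def, rule_format, of "2 * c"]
        s[unfolded sorted_runs_def, rule_format, of "Suc (2 * c)"] le l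
      by (simp_all add: algebra_simps)
    let ?\<rho> = "\<rho>'(RI := ?l, RIE := ?l + h, RJ := ?l + h, RJE := ?l + 2 * h)"
    have w: "wp merge_runs (\<lambda>\<rho>'' A'' B'' ys'' \<tau>''. A'' = A \<and> ys'' = ys \<and> \<tau>'' \<le> 25 + \<tau>' + 5 + 100 * h \<and>
      (\<forall>r. r \<notin> {RO, RI, RJ, RX, RY} \<longrightarrow> \<rho>'' r = ?\<rho> r) \<and> \<rho>'' RO = ?l + 2 * h \<and>
      (\<forall>i<?l. B'' i = B' i) \<and> sorted_on_range B'' ?l (?l + 2 * h) \<and>
      B'' ` {?l..<?l + 2 * h} = A ` {?l..<?l + 2 * h}) ?\<rho> A B' ys (25 + \<tau>')"
      by (rule wp_merge_runs) (use r le s12 A in auto)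
    have "wp merge_runs (\<lambda>\<rho>'' A'' B'' ys'' \<tau>''. I \<rho>'' A'' B'' ys'' \<tau>'' \<and>
        2 * 2 ^ q - \<rho>'' RO < 2 * 2 ^ q - \<rho>' RO) ?\<rho> A B' ys (25 + \<tau>')"
    proof (rule wp_mono[OF w], elim conjE)
      fix \<rho>'' A'' B'' ys'' \<tau>''
      assume post: "A'' = A" "ys'' = ys" "\<tau>'' \<le> 25 + \<tau>' + 5 + 100 * h"
        "\<forall>r. r \<notin> {RO, RI, RJ, RX, RY} \<longrightarrow> \<rho>'' r = ?\<rho> r" "\<rho>'' RO = ?l + 2 * h"
        "\<forall>i<?l. B'' i = B' i" "sorted_on_range B'' ?l (?l + 2 * h)"
        "B'' ` {?l..<?l + 2 * h} = A ` {?l..<?l + 2 * h}"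
      have "{..<?l + 2 * h} = {..<?l} \<union> {?l..<?l + 2 * h}" by auto
      moreover have "B'' ` {..<?l} = B' ` {..<?l}" using post(6) by (intro image_cong) auto
      ultimately have im': "B'' ` {..<?l + 2 * h} = A ` {..<?l + 2 * h}"
        using post(8) im by (simp add: image_Un)
      have "sorted_runs (2 * h) B'' (?l + 2 * h)"
        unfolding sorted_runs_def
      proof (intro allI impI)
        fix e assume e: "Suc e * (2 * h) \<le> ?l + 2 * h"
        then have "e * (2 * h) \<le> c * (2 * h)" using l by (simp add: algebra_simps)
        then have "e \<le> c" using h by simp
        show "sorted_on_range B'' (e * (2 * h)) (Suc e * (2 * h))"
        proof (cases "e = c")
          case True
          then show ?thesis using post(7) l by (simp add: algebra_simps)
        next
          case False
          then have "Suc e \<le> c" using \<open>e \<le> c\<close> by simp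
          then have le': "Suc e * (2 * h) \<le> ?l" using mult_le_mono1[of "Suc e" c "2 * h"] l by (simp add: algebra_simps)
          then have "sorted_on_range B' (e * (2 * h)) (Suc e * (2 * h))"
            using runs by (simp add: sorted_runs_def)
          then show ?thesis
            using post(6) le' unfolding sorted_on_range_def
            by (metis le_less_trans order_less_le_trans)
        qed
      qed
      then show "I \<rho>'' A'' B'' ys'' \<tau>'' \<and> 2 * 2 ^ q - \<rho>'' RO < 2 * 2 ^ q - \<rho>' RO"
        using post fr time h le im' \<open>Suc c \<le> m\<close> l
        by (auto simp: I_def intro!: exI[of _ "Suc c"])
    qed
    then show "wp (OP (Mov RI RO) ;; OP (Add RIE RI RH) ;; OP (Mov RJ RIE) ;; OP (Add RJE RJ RH) ;; merge_runs)
        (\<lambda>\<rho>'' A'' B'' ys'' \<tau>''. I \<rho>'' A'' B'' ys'' \<tau>'' \<and> 2 * 2 ^ q - \<rho>'' RO < 2 * 2 ^ q - \<rho>' RO)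
        \<rho>' A' B' ys' (5 + \<tau>')"
      using le block_le by (auto simp: r small mult_2 add.assoc)
  next
    fix \<rho>' A' B' ys' \<tau>'
    assume I: "I \<rho>' A' B' ys' \<tau>'" and t: "\<not> test_val (Lt RO RNN) \<rho>'"
    obtain e where e: "e \<le> m" "\<rho>' RO = 2 * h * e" using I by (auto simp: I_def)
    have "\<rho>' RNN = 2 * 2 ^ q" using I c by (auto simp: I_def constants_def)
    then have "\<not> \<rho>' RO < 2 * 2 ^ q" using t by simp
    then have "\<not> 2 * h * e < 2 * h * m" unfolding e d .
    then have "e = m" using e(1) h by simp
    then have "\<rho>' RO = 2 * 2 ^ q" using e d by simp
    then show "A' = A \<and> ys' = ys \<and> 5 + \<tau>' \<le> \<tau> + 10 + 130 * 2 ^ q \<and>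
      (\<forall>r. r \<notin> {RO, RI, RIE, RJ, RJE, RX, RY} \<longrightarrow> \<rho>' r = \<rho> r) \<and>
      sorted_runs (2 * h) B' (2 * 2 ^ q) \<and> B' ` {..<2 * 2 ^ q} = A ` {..<2 * 2 ^ q}"
      using I by (auto simp: I_def)
  qed simp_all
qed

end

section \<open>Processing a block\<close>

lemma freq_moment_contrib:
  assumes "finite U" "set xs \<subseteq> U"
  shows "freq_moment k xs = (\<Sum>v\<in>U. contrib k (count_list xs v))"
proof -
  have "(\<Sum>v\<in>U. contrib k (count_list xs v)) = (\<Sum>v\<in>set xs. contrib k (count_list xs v))"
    using assms by (intro sum.mono_neutral_right) (auto simp: contrib_def)
  also have "\<dots> = freq_moment k xs"
    unfolding freq_moment_def by (intro sum.cong) (auto simp: contrib_def count_list_0_iff)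
  finally show ?thesis ..
qed

text \<open>Over a common finite set of symbols the two sums differ only in the term of
  \<open>v\<close>. Additions on both sides avoid truncated subtraction.\<close>

lemma freq_moment_change:
  assumes "\<And>u. u \<noteq> v \<Longrightarrow> count_list ys u = count_list xs u"
  shows "freq_moment k ys + contrib k (count_list xs v) = freq_moment k xs + contrib k (count_list ys v)"
proof -
  let ?U = "insert v (set xs \<union> set ys)"
  have "(\<Sum>u\<in>?U - {v}. contrib k (count_list ys u)) = (\<Sum>u\<in>?U - {v}. contrib k (count_list xs u))"
    using assms by (intro sum.cong) auto
  moreover have "set xs \<subseteq> ?U" "set ys \<subseteq> ?U" by auto
  ultimately show ?thesis
    using freq_moment_contrib[of ?U xs k] freq_moment_contrib[of ?U ys k]
      sum.remove[of ?U v "\<lambda>u. contrib k (count_list xs u)"]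
      sum.remove[of ?U v "\<lambda>u. contrib k (count_list ys u)"]
    by auto
qed

text \<open>Guarantees that the subtraction in \<open>adjust\<close> is not cut off at 0.\<close>

lemma contrib_le_freq_moment: "contrib k (count_list xs v) \<le> freq_moment k xs"
  using freq_moment_contrib[of "insert v (set xs)" xs k, OF _ subset_insertI]
    member_le_sum[of v "insert v (set xs)" "\<lambda>u. contrib k (count_list xs u)"] by simp

lemma freq_moment_le: "freq_moment k xs \<le> length xs ^ (k + 1)"
proof -
  have "freq_moment k xs \<le> (\<Sum>i\<in>set xs. length xs ^ k)"
    unfolding freq_moment_def by (intro sum_mono power_mono) (auto simp: count_le_length)
  also have "\<dots> = card (set xs) * length xs ^ k" by simp
  also have "\<dots> \<le> length xs * length xs ^ k" by (intro mult_le_mono1 card_length)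
  finally show ?thesis by simp
qed

text \<open>
  Positions past the end of the input are clipped to the last one and positions before its
  beginning to 0; the superfluous entries do no harm.
\<close>

definition fill :: com where
  "fill = OP (Lit RJ 0) ;;
     WHILE (Lt RJ RB)
       (OP (Add RX RT RJ) ;; OP (Sub RY RX RN) ;; OP (Sub RG RX REM) ;; OP (Sub RX RX RG) ;;
        OP (PutA RJ RX) ;; OP (Add RI RJ RB) ;; OP (PutA RI RY) ;; OP (Add RJ RJ ROne))"

definition clear :: com where
  "clear = OP (Lit RJ 0) ;; WHILE (Lt RJ RNN) (OP (PutB RJ RZero) ;; OP (Add RJ RJ ROne))"

text \<open>Most symbols of the window may be missing from the array, and then \<open>lookup\<close>
  returns an unrelated index. The two strict comparisons together test equality with the entry
  found. Truncation in \<open>RT - RN\<close> makes the scan start at 0 while the window is still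
  growing.\<close>

definition count :: com where
  "count = OP (Sub RP RT RN) ;;
     WHILE (Lt RP RT)
       (lookup ;; OP (GetA RX RPos) ;;
        IF (Less RX RP) SKIP
          (IF (Less RP RX) SKIP
            (OP (GetB RY RPos) ;; OP (Add RY RY ROne) ;; OP (PutB RPos RY))) ;;
        OP (Add RP RP ROne))"

text \<open>The old contribution is taken out of \<open>RF\<close> before the counter changes and
  the new one is put in afterwards. The symbol is known to occur in the array, so the result of
  \<open>lookup\<close> is used without a further comparison.\<close>

definition adjust :: "nat \<Rightarrow> oper \<Rightarrow> com" where
  "adjust k f = lookup ;; OP (GetB RY RPos) ;; power_of k ;; OP (Sub RF RF RG) ;; OP f ;;
     OP (PutB RPos RY) ;; power_of k ;; OP (Add RF RF RG)"

text \<open>Nothing leaves during the first \<open>n\<close> steps. The test before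
  \<open>Emit\<close> comes after the increment of \<open>RT\<close>, so the first output follows
  the \<open>n\<close>-th insertion. The two subtractions at the start clip the end of the block to
  the end of the input.\<close>

definition roll :: "nat \<Rightarrow> com" where
  "roll k = OP (Add RTE RT RB) ;; OP (Sub RX RTE RE) ;; OP (Sub RTE RTE RX) ;;
     WHILE (Lt RT RTE)
       (IF (Lt RT RN) SKIP (OP (Sub RP RT RN) ;; adjust k (Sub RY RY ROne)) ;;
        OP (Mov RP RT) ;; adjust k (Add RY RY ROne) ;; OP (Add RT RT ROne) ;;
        IF (Lt RT RN) SKIP (OP (Emit RF)))"

context window_machine
begin

lemma positions_iff: "positions A \<longleftrightarrow> A ` {..<2 * 2 ^ q} \<subseteq> {..<length x}"
  by (auto simp: positions_def)

lemma wp_merge_sort: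
  assumes c: "constants \<rho>" and A: "positions A"
  shows "wp merge_sort (\<lambda>\<rho>' A' B' ys' \<tau>'. ys' = ys \<and> \<tau>' \<le> \<tau> + 10 + (q + 1) * (30 + 130 * 2 ^ q) \<and>
      (\<forall>r. r \<notin> {RH, RO, RI, RIE, RJ, RJE, RX, RY} \<longrightarrow> \<rho>' r = \<rho> r) \<and>
      sorted_on_range A' 0 (2 * 2 ^ q) \<and> A' ` {..<2 * 2 ^ q} = A ` {..<2 * 2 ^ q}) \<rho> A B ys \<tau>"
proof -
  define I where "I \<rho>' A' B' ys' \<tau>' \<longleftrightarrow> ys' = ys \<and>
     (\<forall>r. r \<notin> {RH, RO, RI, RIE, RJ, RJE, RX, RY} \<longrightarrow> \<rho>' r = \<rho> r) \<and>
     A' ` {..<2 * 2 ^ q} = A ` {..<2 * 2 ^ q} \<and>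
     (\<exists>e\<le>q + 1. \<rho>' RH = 2 ^ e \<and> \<tau>' \<le> \<tau> + 5 + e * (30 + 130 * 2 ^ q) \<and>
       sorted_runs (2 ^ e) A' (2 * 2 ^ q))"
    for \<rho>' A' and B' :: "nat \<Rightarrow> nat" and ys' and \<tau>' :: nat
  show ?thesis
    unfolding merge_sort_def wp_Seq wp_opers
  proof (rule wp_While[where I = I and \<mu> = "\<lambda>\<rho>. 2 * 2 ^ q - \<rho> RH"])
    show "I (\<rho>(RH := \<rho> ROne)) A B ys (5 + \<tau>)"
    proof -
      have "sorted_runs 1 A (2 * 2 ^ q)"
        by (auto simp: sorted_runs_def sorted_on_range_def less_Suc_eq_le dest: antisym order.trans)
      then show ?thesis
        using c by (auto simp: I_def constants_def intro!: exI[of _ 0])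
    qed
  next
    fix \<rho>' A' B' ys' \<tau>'
    assume I: "I \<rho>' A' B' ys' \<tau>'" and t: "test_val (Lt RH RNN) \<rho>'"
    have [simp]: "ys' = ys" and fr: "\<And>r. r \<notin> {RH, RO, RI, RIE, RJ, RJE, RX, RY} \<Longrightarrow> \<rho>' r = \<rho> r"
      and im: "A' ` {..<2 * 2 ^ q} = A ` {..<2 * 2 ^ q}" using I by (auto simp: I_def)
    obtain e where e: "e \<le> q + 1" "\<rho>' RH = 2 ^ e" "\<tau>' \<le> \<tau> + 5 + e * (30 + 130 * 2 ^ q)"
      "sorted_runs (2 ^ e) A' (2 * 2 ^ q)" using I by (auto simp: I_def)
    have c': "constants \<rho>'" using c fr by (auto simp: constants_def)
    have A': "positions A'" using A im by (simp add: positions_iff)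
    have "(2::nat) ^ e < 2 ^ (q + 1)" using t e c' by (simp add: constants_def)
    then have eq: "e \<le> q" by (metis Suc_eq_plus1 less_Suc_eq_le one_less_numeral_iff power_less_imp_less_exp semiring_norm(76))
    then have le: "(2::nat) ^ e \<le> 2 ^ q" by simp
    \<comment> \<open>The array consists of \<open>2 ^ (q - e)\<close> pairs of runs of length
      \<open>2 ^ e\<close>, the divisibility that \<open>wp_merge_pass\<close> asks for.\<close>
    have "2 * 2 ^ e * 2 ^ (q - e) = (2::nat) * 2 ^ q" using eq by (simp flip: power_add add: mult.assoc)
    note pass = wp_merge_pass[OF c' A' e(2) one_le_power this e(4), where B = B' and ys = ys and \<tau> = "5 + \<tau>'"]
    show "wp (merge_pass ;; OP Swap ;; OP (Add RH RH RH))
       (\<lambda>\<rho>'' A'' B'' ys'' \<tau>''. I \<rho>'' A'' B'' ys'' \<tau>'' \<and> 2 * 2 ^ q - \<rho>'' RH < 2 * 2 ^ q - \<rho>' RH)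
       \<rho>' A' B' ys' (5 + \<tau>')"
      unfolding wp_Seq
    proof (simp only: \<open>ys' = ys\<close>, rule wp_mono[OF pass], simp, elim conjE)
      fix \<rho>'' A'' B'' ys'' \<tau>''
      assume post: "A'' = A'" "ys'' = ys" "\<tau>'' \<le> 5 + \<tau>' + 10 + 130 * 2 ^ q"
        "\<forall>r. r \<notin> {RO, RI, RIE, RJ, RJE, RX, RY} \<longrightarrow> \<rho>'' r = \<rho>' r"
        "sorted_runs (2 * 2 ^ e) B'' (2 * 2 ^ q)" "B'' ` {..<2 * 2 ^ q} = A' ` {..<2 * 2 ^ q}"
      have h: "\<rho>'' RH = 2 ^ e" using post e by simp
      have "I (\<rho>''(RH := 2 * 2 ^ e)) B'' A'' ys'' (10 + \<tau>'')"
        unfolding I_def using post fr im e(3) eq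
        by (auto intro!: exI[of _ "Suc e"] simp: algebra_simps)
      moreover have "2 * 2 ^ q - 2 * 2 ^ e < 2 * 2 ^ q - (2::nat) ^ e"
        using le by (intro diff_less_mono2) (auto intro: le_less_trans[OF le])
      ultimately show "wp (OP Swap) (wp (OP (Add RH RH RH))
         (\<lambda>\<rho>'' A'' B'' ys'' \<tau>''. I \<rho>'' A'' B'' ys'' \<tau>'' \<and> 2 * 2 ^ q - \<rho>'' RH < 2 * 2 ^ q - \<rho>' RH))
         \<rho>'' A'' B'' ys'' \<tau>''"
        using le block_le e(2) by (auto simp: h mult_2[symmetric] intro!: small)
    qed
  next
    fix \<rho>' A' B' ys' \<tau>'
    assume I: "I \<rho>' A' B' ys' \<tau>'" and t: "\<not> test_val (Lt RH RNN) \<rho>'"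
    obtain e where e: "e \<le> q + 1" "\<rho>' RH = 2 ^ e" "\<tau>' \<le> \<tau> + 5 + e * (30 + 130 * 2 ^ q)"
      "sorted_runs (2 ^ e) A' (2 * 2 ^ q)" using I by (auto simp: I_def)
    have "\<rho>' RNN = 2 * 2 ^ q" using I c by (auto simp: I_def constants_def)
    then have "\<not> (2::nat) ^ e < 2 ^ (q + 1)" using t e by simp
    then have "\<not> e < q + 1" using power_strict_increasing[of e "q + 1" "2::nat"] by auto
    then have eq: "e = q + 1" using e(1) by simp
    have "sorted_on_range A' 0 (2 * 2 ^ q)"
      using e(4)[unfolded sorted_runs_def, rule_format, of 0] by (simp add: eq)
    then show "ys' = ys \<and> 5 + \<tau>' \<le> \<tau> + 10 + (q + 1) * (30 + 130 * 2 ^ q) \<and>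
      (\<forall>r. r \<notin> {RH, RO, RI, RIE, RJ, RJE, RX, RY} \<longrightarrow> \<rho>' r = \<rho> r) \<and>
      sorted_on_range A' 0 (2 * 2 ^ q) \<and> A' ` {..<2 * 2 ^ q} = A ` {..<2 * 2 ^ q}"
      using I e(3) unfolding eq by (auto simp: I_def)
  qed simp
qed

lemma wp_fill:
  assumes c: "constants \<rho>" and t: "\<rho> RT < 2 * n - 1"
  shows "wp fill (\<lambda>\<rho>' A' B' ys' \<tau>'. B' = B \<and> ys' = ys \<and> \<tau>' \<le> \<tau> + 10 + 45 * 2 ^ q \<and>
      (\<forall>r. r \<notin> {RI, RJ, RX, RY, RG} \<longrightarrow> \<rho>' r = \<rho> r) \<and>
      (\<forall>j<2 ^ q. A' j = min (\<rho> RT + j) (2 * n - 2) \<and> A' (j + 2 ^ q) = \<rho> RT + j - n)) \<rho> A B ys \<tau>"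
proof -
  define I where "I \<rho>' A' B' ys' \<tau>' \<longleftrightarrow> B' = B \<and> ys' = ys \<and> \<tau>' \<le> \<tau> + 5 + 45 * \<rho>' RJ \<and>
     (\<forall>r. r \<notin> {RI, RJ, RX, RY, RG} \<longrightarrow> \<rho>' r = \<rho> r) \<and> \<rho>' RJ \<le> 2 ^ q \<and>
     (\<forall>j<\<rho>' RJ. A' j = min (\<rho> RT + j) (2 * n - 2) \<and> A' (j + 2 ^ q) = \<rho> RT + j - n)"
    for \<rho>' A' B' ys' and \<tau>' :: nat
  show ?thesis
    unfolding fill_def wp_Seq wp_opers
  proof (rule conjI[OF _ wp_While[where I = I and \<mu> = "\<lambda>\<rho>. 2 ^ q - \<rho> RJ"]])
    fix \<rho>' A' B' ys' \<tau>'
    assume I: "I \<rho>' A' B' ys' \<tau>'" and "test_val (Lt RJ RB) \<rho>'"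
    let ?j = "\<rho>' RJ"
    have r: "\<rho>' RT = \<rho> RT" "\<rho>' RN = n" "\<rho>' REM = 2 * n - 2" "\<rho>' RB = 2 ^ q" "\<rho>' ROne = 1"
      using c I by (auto simp: constants_def I_def)
    have j: "?j < 2 ^ q" using \<open>test_val (Lt RJ RB) \<rho>'\<close> r by simp
    have b: "\<rho> RT + ?j < 2 ^ w" "?j + 2 ^ q < 2 ^ w" "?j + 1 < 2 ^ w" "?j < cap" "?j + 2 ^ q < cap"
      using j t block_le room by (auto intro!: small)
    \<comment> \<open>Truncated subtraction computes the minimum,
      \<open>v - (v - c) = min v c\<close>; this is the clipping without a branch.\<close>
    have m: "\<rho> RT + ?j - (\<rho> RT + ?j - (2 * n - 2)) = min (\<rho> RT + ?j) (2 * n - 2)" by simp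
    show "wp (OP (Add RX RT RJ) ;; OP (Sub RY RX RN) ;; OP (Sub RG RX REM) ;; OP (Sub RX RX RG) ;;
        OP (PutA RJ RX) ;; OP (Add RI RJ RB) ;; OP (PutA RI RY) ;; OP (Add RJ RJ ROne))
       (\<lambda>\<rho>'' A'' B'' ys'' \<tau>''. I \<rho>'' A'' B'' ys'' \<tau>'' \<and> 2 ^ q - \<rho>'' RJ < 2 ^ q - \<rho>' RJ)
       \<rho>' A' B' ys' (5 + \<tau>')"
      using b j I by (auto simp: r m I_def less_Suc_eq intro!: diff_less_mono2)
  next
    fix \<rho>' A' B' ys' \<tau>'
    assume I: "I \<rho>' A' B' ys' \<tau>'" and "\<not> test_val (Lt RJ RB) \<rho>'"
    moreover have "\<rho>' RB = 2 ^ q" using c I by (auto simp: constants_def I_def)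
    ultimately have "\<rho>' RJ = 2 ^ q" by (auto simp: I_def)
    then show "B' = B \<and> ys' = ys \<and> 5 + \<tau>' \<le> \<tau> + 10 + 45 * 2 ^ q \<and>
      (\<forall>r. r \<notin> {RI, RJ, RX, RY, RG} \<longrightarrow> \<rho>' r = \<rho> r) \<and>
      (\<forall>j<2 ^ q. A' j = min (\<rho> RT + j) (2 * n - 2) \<and> A' (j + 2 ^ q) = \<rho> RT + j - n)"
      using I by (auto simp: I_def)
  qed (auto simp: I_def)
qed

lemma wp_clear:
  assumes c: "constants \<rho>"
  shows "wp clear (\<lambda>\<rho>' A' B' ys' \<tau>'. A' = A \<and> ys' = ys \<and> \<tau>' \<le> \<tau> + 10 + 30 * 2 ^ q \<and>
      (\<forall>r. r \<noteq> RJ \<longrightarrow> \<rho>' r = \<rho> r) \<and> (\<forall>j<2 * 2 ^ q. B' j = 0)) \<rho> A B ys \<tau>"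
proof -
  define I where "I \<rho>' A' B' ys' \<tau>' \<longleftrightarrow> A' = A \<and> ys' = ys \<and> \<tau>' \<le> \<tau> + 5 + 15 * \<rho>' RJ \<and>
     (\<forall>r. r \<noteq> RJ \<longrightarrow> \<rho>' r = \<rho> r) \<and> \<rho>' RJ \<le> 2 * 2 ^ q \<and> (\<forall>j<\<rho>' RJ. B' j = (0::nat))"
    for \<rho>' A' B' ys' and \<tau>' :: nat
  show ?thesis
    unfolding clear_def wp_Seq wp_opers
  proof (rule conjI[OF _ wp_While[where I = I and \<mu> = "\<lambda>\<rho>. 2 * 2 ^ q - \<rho> RJ"]])
    fix \<rho>' A' B' ys' \<tau>'
    assume I: "I \<rho>' A' B' ys' \<tau>'" and "test_val (Lt RJ RNN) \<rho>'"
    let ?j = "\<rho>' RJ"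
    have r: "\<rho>' RZero = 0" "\<rho>' RNN = 2 * 2 ^ q" "\<rho>' ROne = 1"
      using c I by (auto simp: constants_def I_def)
    have j: "?j < 2 * 2 ^ q" using \<open>test_val (Lt RJ RNN) \<rho>'\<close> r by simp
    have b: "?j + 1 < 2 ^ w" "?j < cap"
      using j block_le room by (auto intro!: small)
    show "wp (OP (PutB RJ RZero) ;; OP (Add RJ RJ ROne))
       (\<lambda>\<rho>'' A'' B'' ys'' \<tau>''. I \<rho>'' A'' B'' ys'' \<tau>'' \<and> 2 * 2 ^ q - \<rho>'' RJ < 2 * 2 ^ q - \<rho>' RJ)
       \<rho>' A' B' ys' (5 + \<tau>')"
      using b j I by (auto simp: r I_def less_Suc_eq intro!: diff_less_mono2)
  next
    fix \<rho>' A' B' ys' \<tau>'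
    assume I: "I \<rho>' A' B' ys' \<tau>'" and "\<not> test_val (Lt RJ RNN) \<rho>'"
    moreover have "\<rho>' RNN = 2 * 2 ^ q" using c I by (auto simp: constants_def I_def)
    ultimately have "\<rho>' RJ = 2 * 2 ^ q" by (auto simp: I_def)
    then show "A' = A \<and> ys' = ys \<and> 5 + \<tau>' \<le> \<tau> + 10 + 30 * 2 ^ q \<and>
      (\<forall>r. r \<noteq> RJ \<longrightarrow> \<rho>' r = \<rho> r) \<and> (\<forall>j<2 * 2 ^ q. B' j = 0)"
      using I by (auto simp: I_def)
  qed (auto simp: I_def)
qed

section \<open>Window contents and the counters of the active symbols\<close>

definition seg :: "nat \<Rightarrow> nat \<Rightarrow> 'a list" where
  "seg l u = map key [l..<u]"

text \<open>Only the slot at the first occurrence of a key is a counter; slots at repeated keys are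
  left unspecified.\<close>

definition counts :: "(nat \<Rightarrow> nat) \<Rightarrow> (nat \<Rightarrow> nat) \<Rightarrow> 'a list \<Rightarrow> bool" where
  "counts A B xs \<longleftrightarrow> (\<forall>v f. is_first A v f \<longrightarrow> B f = count_list xs v)"

lemma is_first_unique: "is_first A v f \<Longrightarrow> is_first A v g \<Longrightarrow> f = g"
  unfolding is_first_def by (metis nat_neq_iff)

lemma is_first_exists:
  assumes "j < 2 * 2 ^ q" "key (A j) = v" shows "\<exists>f. is_first A v f"
proof -
  let ?f = "LEAST i. key (A i) = v"
  have "key (A ?f) = v" using assms(2) by (rule LeastI)
  moreover have "?f \<le> j" using assms(2) by (rule Least_le)
  moreover have "\<forall>i<?f. key (A i) \<noteq> v" using not_less_Least by blast
  ultimately have "is_first A v ?f"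
    using assms(1) unfolding is_first_def by (meson le_less_trans)
  then show ?thesis ..
qed

text \<open>Different keys have different first slots, so writing one counter disturbs no
  other.\<close>

lemma counts_change:
  assumes "counts A B xs" "is_first A v f" "\<And>u. u \<noteq> v \<Longrightarrow> count_list ys u = count_list xs u"
  shows "counts A (B(f := count_list ys v)) ys"
  unfolding counts_def
proof (intro allI impI)
  fix u g assume g: "is_first A u g"
  show "(B(f := count_list ys v)) g = count_list ys u"
  proof (cases "u = v")
    case True
    then show ?thesis using is_first_unique[OF g] assms(2) by auto
  next
    case False
    then have "g \<noteq> f" using g assms(2) by (auto simp: is_first_def)
    then show ?thesis using False g assms(1,3) by (auto simp: counts_def)
  qed
qed

lemma seg_Suc: "l \<le> u \<Longrightarrow> seg l (Suc u) = seg l u @ [key u]"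
  by (simp add: seg_def)

lemma seg_Cons: "l < u \<Longrightarrow> seg l u = key l # seg (Suc l) u"
  by (simp add: seg_def upt_conv_Cons)

lemma length_seg [simp]: "length (seg l u) = u - l"
  by (simp add: seg_def)


lemma wp_count:
  assumes c: "constants \<rho>" and A: "positions A" and s: "sorted_on_range A 0 (2 * 2 ^ q)"
    and t: "\<rho> RT \<le> length x" and B: "\<forall>j<2 * 2 ^ q. B j = 0"
  shows "wp count (\<lambda>\<rho>' A' B' ys' \<tau>'. A' = A \<and> ys' = ys \<and> \<tau>' \<le> \<tau> + 10 + n * (100 + 40 * q) \<and>
      (\<forall>r. r \<notin> {RP, RPos, RStep, RX, RY} \<longrightarrow> \<rho>' r = \<rho> r) \<and>
      counts A B' (seg (\<rho> RT - n) (\<rho> RT))) \<rho> A B ys \<tau>"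
proof -
  let ?l = "\<rho> RT - n"
  define I where "I \<rho>' A' B' ys' \<tau>' \<longleftrightarrow> A' = A \<and> ys' = ys \<and>
     \<tau>' \<le> \<tau> + 5 + (\<rho>' RP - ?l) * (100 + 40 * q) \<and>
     (\<forall>r. r \<notin> {RP, RPos, RStep, RX, RY} \<longrightarrow> \<rho>' r = \<rho> r) \<and>
     ?l \<le> \<rho>' RP \<and> \<rho>' RP \<le> \<rho> RT \<and> counts A B' (seg ?l (\<rho>' RP))"
    for \<rho>' A' B' ys' and \<tau>' :: nat
  have n': "\<rho> RN = n" using c by (simp add: constants_def)
  show ?thesis
    unfolding count_def wp_Seq wp_opers
  proof (rule wp_While[where I = I and \<mu> = "\<lambda>\<rho>'. \<rho> RT - \<rho>' RP"])
    show "I (\<rho>(RP := \<rho> RT - \<rho> RN)) A B ys (5 + \<tau>)"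
      using B by (auto simp: I_def n' counts_def is_first_def seg_def)
  next
    fix \<rho>' A' B' ys' \<tau>'
    assume I: "I \<rho>' A' B' ys' \<tau>'" and "test_val (Lt RP RT) \<rho>'"
    let ?p = "\<rho>' RP" and ?v = "key (\<rho>' RP)"
    have [simp]: "A' = A" "ys' = ys" and fr: "\<And>r. r \<notin> {RP, RPos, RStep, RX, RY} \<Longrightarrow> \<rho>' r = \<rho> r"
      and time: "\<tau>' \<le> \<tau> + 5 + (?p - ?l) * (100 + 40 * q)"
      and l: "?l \<le> ?p" and cnt: "counts A B' (seg ?l ?p)" using I by (auto simp: I_def)
    have c': "constants \<rho>'" using c fr by (auto simp: constants_def)
    have p: "?p < \<rho> RT" using \<open>test_val (Lt RP RT) \<rho>'\<close> fr by simp
    then have px: "?p < length x" using t by simp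
    have count_v: "count_list (seg ?l (Suc ?p)) u = count_list (seg ?l ?p) u + (if u = ?v then 1 else 0)" for u
      using l by (simp add: seg_Suc)
    note look = wp_lookup[OF c' px A s, where B = B' and ys = ys and \<tau> = "5 + \<tau>'"]
    show "wp (lookup ;; OP (GetA RX RPos) ;;
        IF (Less RX RP) SKIP
          (IF (Less RP RX) SKIP
            (OP (GetB RY RPos) ;; OP (Add RY RY ROne) ;; OP (PutB RPos RY))) ;;
        OP (Add RP RP ROne))
       (\<lambda>\<rho>'' A'' B'' ys'' \<tau>''. I \<rho>'' A'' B'' ys'' \<tau>'' \<and> \<rho> RT - \<rho>'' RP < \<rho> RT - \<rho>' RP)
       \<rho>' A' B' ys' (5 + \<tau>')"
      unfolding wp_Seq[of lookup]
    proof (simp only: \<open>ys' = ys\<close> \<open>A' = A\<close>, rule wp_mono[OF look], elim conjE)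
      fix \<rho>'' A'' B'' ys'' \<tau>''
      assume post: "A'' = A" "B'' = B'" "ys'' = ys" "\<tau>'' \<le> 5 + \<tau>' + 60 + 40 * q"
        "\<forall>r. r \<notin> {RPos, RStep, RX, RY} \<longrightarrow> \<rho>'' r = \<rho>' r" "\<rho>'' RPos < 2 * 2 ^ q"
        "\<forall>f. is_first A ?v f \<longrightarrow> \<rho>'' RPos = f"
      let ?f = "\<rho>'' RPos"
      have r: "\<rho>'' RP = ?p" "\<rho>'' ROne = 1" "?f < cap" "A ?f < length x" "Suc ?p < 2 ^ w"
        using post c' fr room A p t length_x small[of "Suc ?p"] by (auto simp: constants_def positions_def)
      \<comment> \<open>Of the \<open>100 + 40 * q\<close> units per position, 5 pay for the loop
        test, \<open>60 + 40 * q\<close> for \<open>lookup\<close>, and 35 for the at most seven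
        operations and tests that follow.\<close>
      have time': "35 + \<tau>'' \<le> \<tau> + 5 + (Suc ?p - ?l) * (100 + 40 * q)"
      proof -
        have "(Suc ?p - ?l) * (100 + 40 * q) = (100 + 40 * q) + (?p - ?l) * (100 + 40 * q)"
          using l by (simp add: Suc_diff_le)
        then show ?thesis using post(4) time by linarith
      qed
      have dec: "\<rho> RT - Suc ?p < \<rho> RT - ?p" using p by simp
      have I': "I \<rho>3 A B3 ys t3"
        if "\<rho>3 RP = Suc ?p" "\<forall>r. r \<notin> {RP, RPos, RStep, RX, RY} \<longrightarrow> \<rho>3 r = \<rho>'' r"
          "counts A B3 (seg ?l (Suc ?p))" "t3 \<le> 35 + \<tau>''" for \<rho>3 B3 t3
        using that time' l p post(5) fr by (auto simp: I_def)
      show "wp (OP (GetA RX RPos) ;;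
          IF (Less RX RP) SKIP
            (IF (Less RP RX) SKIP
              (OP (GetB RY RPos) ;; OP (Add RY RY ROne) ;; OP (PutB RPos RY))) ;;
          OP (Add RP RP ROne))
         (\<lambda>\<rho>'' A'' B'' ys'' \<tau>''. I \<rho>'' A'' B'' ys'' \<tau>'' \<and> \<rho> RT - \<rho>'' RP < \<rho> RT - \<rho>' RP)
         \<rho>'' A'' B'' ys'' \<tau>''"
      proof (cases "key (A ?f) = ?v")
        case True
        then obtain g where g: "is_first A ?v g" using is_first_exists post(6) by blast
        then have f: "is_first A ?v ?f" using post(7) by auto
        have Bf: "B' ?f = count_list (seg ?l ?p) ?v" using cnt f by (simp add: counts_def)
        have "count_list (seg ?l ?p) ?v \<le> ?p - ?l"
          using count_le_length[of "seg ?l ?p" ?v] by simp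
        then have b: "Suc (B' ?f) < 2 ^ w" using p t length_x Bf by (intro small) auto
        have "counts A (B'(?f := count_list (seg ?l (Suc ?p)) ?v)) (seg ?l (Suc ?p))"
          by (rule counts_change[OF cnt f]) (simp add: count_v)
        then have "counts A (B'(?f := Suc (B' ?f))) (seg ?l (Suc ?p))"
          by (simp add: count_v Bf)
        then show ?thesis
          using px r b True by (auto simp: post(1-3) intro!: I' dec split: if_splits)
      next
        case False
        \<comment> \<open>Had the key occurred, \<open>lookup\<close> would have returned its first
          slot, where the key matches. So it has no counter, and advancing over it changes
          none.\<close>
        then have "\<not> is_first A ?v f" for f using post(7) by (auto simp: is_first_def)
        then have "counts A B' (seg ?l (Suc ?p))"
          using cnt by (auto simp: counts_def count_v)
        then show ?thesis
          using px r False by (auto simp: post(1-3) intro!: I' dec)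
      qed
    qed
  next
    fix \<rho>' A' B' ys' \<tau>'
    assume I: "I \<rho>' A' B' ys' \<tau>'" and t: "\<not> test_val (Lt RP RT) \<rho>'"
    have "\<rho>' RP = \<rho> RT" using I t by (auto simp: I_def)
    moreover have "5 + \<tau>' \<le> \<tau> + 10 + n * (100 + 40 * q)"
    proof -
      have "(\<rho> RT - ?l) * (100 + 40 * q) \<le> n * (100 + 40 * q)"
        by (intro mult_le_mono1) simp
      moreover have "\<tau>' \<le> \<tau> + 5 + (\<rho> RT - ?l) * (100 + 40 * q)"
        using I unfolding I_def \<open>\<rho>' RP = \<rho> RT\<close> by blast
      ultimately show ?thesis by linarith
    qed
    ultimately show "A' = A \<and> ys' = ys \<and> 5 + \<tau>' \<le> \<tau> + 10 + n * (100 + 40 * q) \<and>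
      (\<forall>r. r \<notin> {RP, RPos, RStep, RX, RY} \<longrightarrow> \<rho>' r = \<rho> r) \<and>
      counts A B' (seg (\<rho> RT - n) (\<rho> RT))"
      using I by (auto simp: I_def)
  qed simp
qed

lemma freq_moment_word: "length xs \<le> n \<Longrightarrow> freq_moment k xs < 2 ^ w"
proof -
  assume "length xs \<le> n"
  then have "length xs ^ (k + 1) \<le> (n + 1) ^ (k + 1)" by (intro power_mono) auto
  also have "\<dots> \<le> (n + 1) ^ (k + 2)" by (intro power_increasing) auto
  also have "\<dots> < 256 * (n + 1) ^ (k + 2)" by simp
  finally show ?thesis using word freq_moment_le[of k xs] by simp
qed

text \<open>Treats removal and insertion together: \<open>xs\<close> and \<open>zs\<close> are the
  windows before and after, which differ only in the count of the key at \<open>RP\<close>. The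
  hypothesis on \<open>j\<close> says that this key is active in the block.\<close>

lemma wp_adjust:
  assumes c: "constants \<rho>" and p: "\<rho> RP < length x" and A: "positions A"
    and s: "sorted_on_range A 0 (2 * 2 ^ q)" and cnt: "counts A B xs"
    and F: "\<rho> RF = freq_moment k xs" and mem: "j < 2 * 2 ^ q" "key (A j) = key (\<rho> RP)"
    and len: "length xs \<le> n" "length zs \<le> n"
    and other: "\<And>u. u \<noteq> key (\<rho> RP) \<Longrightarrow> count_list zs u = count_list xs u"
    and f: "f = Sub RY RY ROne \<and> count_list zs (key (\<rho> RP)) = count_list xs (key (\<rho> RP)) - 1 \<or>
      f = Add RY RY ROne \<and> count_list zs (key (\<rho> RP)) = count_list xs (key (\<rho> RP)) + 1"
  shows "wp (adjust k f) (\<lambda>\<rho>' A' B' ys' \<tau>'. A' = A \<and> ys' = ys \<and> \<tau>' \<le> \<tau> + 105 + 40 * q + 10 * k \<and>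
      (\<forall>r. r \<notin> {RPos, RStep, RX, RY, RG, RF} \<longrightarrow> \<rho>' r = \<rho> r) \<and>
      counts A B' zs \<and> \<rho>' RF = freq_moment k zs) \<rho> A B ys \<tau>" (is "wp _ ?Q _ _ _ _ _")
  unfolding adjust_def wp_Seq[of lookup]
proof (rule wp_mono[OF wp_lookup[OF c p A s, where B = B and ys = ys and \<tau> = \<tau>]], elim conjE)
  let ?v = "key (\<rho> RP)"
  let ?a = "count_list xs ?v" and ?b = "count_list zs ?v"
  fix \<rho>' A' B' ys' \<tau>'
  assume post: "A' = A" "B' = B" "ys' = ys" "\<tau>' \<le> \<tau> + 60 + 40 * q"
    "\<forall>r. r \<notin> {RPos, RStep, RX, RY} \<longrightarrow> \<rho>' r = \<rho> r" "\<rho>' RPos < 2 * 2 ^ q"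
    "\<forall>f. is_first A ?v f \<longrightarrow> \<rho>' RPos = f"
  have r: "\<rho>' RZero = 0" "\<rho>' ROne = 1" "\<rho>' RF = freq_moment k xs" "\<rho>' RPos < cap"
    using post c F room by (auto simp: constants_def)
  obtain g where "is_first A ?v g" using is_first_exists mem by blast
  then have first: "is_first A ?v (\<rho>' RPos)" using post(7) by auto
  then have a: "B (\<rho>' RPos) = ?a" using cnt by (simp add: counts_def)
  have le: "?a \<le> n" "?b \<le> n"
    using count_le_length[of xs ?v] count_le_length[of zs ?v] len by linarith+
  have new: "freq_moment k xs - contrib k ?a + contrib k ?b = freq_moment k zs"
    using freq_moment_change[of ?v zs xs k, OF other] contrib_le_freq_moment[of k xs ?v] by simp
  have cnt': "counts A (B(\<rho>' RPos := ?b)) zs" by (rule counts_change[OF cnt first other])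
  have Suc_w: "Suc ?a < 2 ^ w" using le by (intro small) simp
  have Q: "?Q \<rho>3 A (B(\<rho>' RPos := ?b)) ys t3"
    if "\<forall>r. r \<notin> {RY, RG, RF} \<longrightarrow> \<rho>3 r = \<rho>' r" "\<rho>3 RF = freq_moment k zs"
      "t3 \<le> 45 + 10 * k + \<tau>'" for \<rho>3 t3
    using that post cnt' by auto
  have tail: "wp (OP (PutB RPos RY) ;; power_of k ;; OP (Add RF RF RG)) ?Q \<rho>2 A B ys t2"
    if "\<forall>r. r \<notin> {RY, RG, RF} \<longrightarrow> \<rho>2 r = \<rho>' r" "\<rho>2 RF = freq_moment k xs - contrib k ?a"
      "\<rho>2 RY = ?b" "t2 \<le> 25 + 5 * k + \<tau>'" for \<rho>2 t2
  proof -
    have r2: "\<rho>2 RPos = \<rho>' RPos" "\<rho>2 RZero = 0" using that r by auto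
    have "wp (power_of k) (wp (OP (Add RF RF RG)) ?Q) \<rho>2 A (B(\<rho>' RPos := ?b)) ys (5 + t2)"
    proof (rule wp_power_of)
      fix t' assume t': "t' \<le> 5 + t2 + 10 + 5 * k"
      show "wp (OP (Add RF RF RG)) ?Q (\<rho>2(RG := contrib k (\<rho>2 RY))) A (B(\<rho>' RPos := ?b)) ys t'"
      proof -
        have F: "(\<rho>2(RG := contrib k (\<rho>2 RY))) RF + (\<rho>2(RG := contrib k (\<rho>2 RY))) RG = freq_moment k zs"
          using that new by simp
        show ?thesis
          unfolding wp_opers(3) F
          by (rule conjI[OF freq_moment_word[OF len(2)] Q]) (use that t' in auto)
      qed
    qed (use r2 le that in auto)
    then show ?thesis using r r2 that by simp
  qed
  have "wp (power_of k) (wp (OP (Sub RF RF RG) ;; OP f ;; OP (PutB RPos RY) ;; power_of k ;; OP (Add RF RF RG)) ?Q)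
     (\<rho>'(RY := ?a)) A B ys (5 + \<tau>')"
  proof (rule wp_power_of)
    fix t' assume t': "t' \<le> 5 + \<tau>' + 10 + 5 * k"
    let ?\<rho> = "\<rho>'(RY := ?a, RG := contrib k ?a, RF := freq_moment k xs - contrib k ?a, RY := ?b)"
    have "wp (OP (PutB RPos RY) ;; power_of k ;; OP (Add RF RF RG)) ?Q ?\<rho> A B ys (5 + (5 + t'))"
      using t' by (intro tail) auto
    then show "wp (OP (Sub RF RF RG) ;; OP f ;; OP (PutB RPos RY) ;; power_of k ;; OP (Add RF RF RG)) ?Q
        ((\<rho>'(RY := ?a))(RG := contrib k ((\<rho>'(RY := ?a)) RY))) A B ys t'"
      unfolding wp_Seq[of "OP (Sub RF RF RG)"] wp_Seq[of "OP f"]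
      using f r Suc_w by (elim disjE conjE) (simp_all del: wp_Seq)
  qed (use r le in auto)
  then show "wp (OP (GetB RY RPos) ;; power_of k ;; OP (Sub RF RF RG) ;; OP f ;;
     OP (PutB RPos RY) ;; power_of k ;; OP (Add RF RF RG)) ?Q \<rho>' A' B' ys' \<tau>'"
    unfolding wp_Seq[of "OP (GetB RY RPos)"] wp_opers wp_Seq[of "power_of k"] post(1-3)
    using r a by simp
qed


text \<open>What has been written after \<open>t\<close> insertions. The number
  \<open>Suc t - n\<close> of completed windows truncates to 0 as long as fewer than
  \<open>n\<close> symbols have been inserted.\<close>

definition outputs :: "nat \<Rightarrow> nat list" where
  "outputs t = map (\<lambda>i. freq_moment k (seg i (i + n))) [0..<Suc t - n]"

lemma outputs_Suc:
  "outputs (Suc t) = outputs t @ (if Suc t < n then [] else [freq_moment k (seg (Suc t - n) (Suc t))])"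
  by (auto simp: outputs_def Suc_diff_le)

text \<open>Describes the middle of a step, when the oldest symbol is gone and the new one has not
  arrived. For \<open>t < n\<close> the window is unchanged because both left ends truncate to
  0.\<close>

lemma wp_remove:
  assumes c: "constants \<rho>" and A: "positions A" and s: "sorted_on_range A 0 (2 * 2 ^ q)"
    and t: "\<rho> RT = t" "t < length x"
    and cnt: "counts A B (seg (t - n) t)" and F: "\<rho> RF = freq_moment k (seg (t - n) t)"
    and mem: "j < 2 * 2 ^ q" "key (A j) = key (t - n)"
  shows "wp (IF (Lt RT RN) SKIP (OP (Sub RP RT RN) ;; adjust k (Sub RY RY ROne)))
      (\<lambda>\<rho>' A' B' ys' \<tau>'. A' = A \<and> ys' = ys \<and> \<tau>' \<le> \<tau> + 115 + 40 * q + 10 * k \<and>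
      (\<forall>r. r \<notin> {RP, RPos, RStep, RX, RY, RG, RF} \<longrightarrow> \<rho>' r = \<rho> r) \<and>
      counts A B' (seg (Suc t - n) t) \<and> \<rho>' RF = freq_moment k (seg (Suc t - n) t)) \<rho> A B ys \<tau>"
proof (cases "t < n")
  case True
  then have "Suc t - n = t - n" by simp
  then show ?thesis using True c cnt F t by (simp add: constants_def)
next
  case False
  have n': "\<rho> RN = n" using c by (simp add: constants_def)
  have sg: "seg (t - n) t = key (t - n) # seg (Suc t - n) t"
    using False n by (simp add: seg_Cons[of "t - n" t] Suc_diff_le)
  let ?\<rho> = "\<rho>(RP := t - n)"
  have "wp (adjust k (Sub RY RY ROne)) (\<lambda>\<rho>' A' B' ys' \<tau>'. A' = A \<and> ys' = ys \<and>
      \<tau>' \<le> 10 + \<tau> + 105 + 40 * q + 10 * k \<and>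
      (\<forall>r. r \<notin> {RPos, RStep, RX, RY, RG, RF} \<longrightarrow> \<rho>' r = ?\<rho> r) \<and>
      counts A B' (seg (Suc t - n) t) \<and> \<rho>' RF = freq_moment k (seg (Suc t - n) t)) ?\<rho> A B ys (10 + \<tau>)"
    by (rule wp_adjust[OF _ _ A s cnt]) (use c t F mem sg n False in \<open>auto simp: constants_def\<close>)
  then have "wp (adjust k (Sub RY RY ROne)) (\<lambda>\<rho>' A' B' ys' \<tau>'. A' = A \<and> ys' = ys \<and> \<tau>' \<le> \<tau> + 115 + 40 * q + 10 * k \<and>
      (\<forall>r. r \<notin> {RP, RPos, RStep, RX, RY, RG, RF} \<longrightarrow> \<rho>' r = \<rho> r) \<and>
      counts A B' (seg (Suc t - n) t) \<and> \<rho>' RF = freq_moment k (seg (Suc t - n) t)) ?\<rho> A B ys (10 + \<tau>)"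
    by (rule wp_mono) auto
  then show ?thesis
    unfolding wp_If wp_Seq wp_opers using False t n' by simp
qed

lemma wp_insert:
  assumes c: "constants \<rho>" and A: "positions A" and s: "sorted_on_range A 0 (2 * 2 ^ q)"
    and t: "\<rho> RT = t" "t < length x"
    and cnt: "counts A B (seg (Suc t - n) t)" and F: "\<rho> RF = freq_moment k (seg (Suc t - n) t)"
    and mem: "j < 2 * 2 ^ q" "key (A j) = key t"
  shows "wp (OP (Mov RP RT) ;; adjust k (Add RY RY ROne) ;; OP (Add RT RT ROne) ;;
        IF (Lt RT RN) SKIP (OP (Emit RF)))
      (\<lambda>\<rho>' A' B' ys' \<tau>'. A' = A \<and>
      ys' = ys @ (if Suc t < n then [] else [freq_moment k (seg (Suc t - n) (Suc t))]) \<and>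
      \<tau>' \<le> \<tau> + 125 + 40 * q + 10 * k \<and> \<rho>' RT = Suc t \<and>
      (\<forall>r. r \<notin> {RP, RPos, RStep, RX, RY, RG, RF, RT} \<longrightarrow> \<rho>' r = \<rho> r) \<and>
      counts A B' (seg (Suc t - n) (Suc t)) \<and> \<rho>' RF = freq_moment k (seg (Suc t - n) (Suc t))) \<rho> A B ys \<tau>"
    (is "wp _ ?Q _ _ _ _ _")
proof -
  have r: "\<rho> RN = n" "\<rho> ROne = 1" using c by (simp_all add: constants_def)
  have sg: "seg (Suc t - n) (Suc t) = seg (Suc t - n) t @ [key t]" using n by (simp add: seg_Suc)
  let ?\<rho> = "\<rho>(RP := t)"
  have tw: "Suc t < 2 ^ w" using t length_x by (intro small) simp
  have "wp (adjust k (Add RY RY ROne)) (\<lambda>\<rho>' A' B' ys' \<tau>'. A' = A \<and> ys' = ys \<and>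
      \<tau>' \<le> 5 + \<tau> + 105 + 40 * q + 10 * k \<and>
      (\<forall>r. r \<notin> {RPos, RStep, RX, RY, RG, RF} \<longrightarrow> \<rho>' r = ?\<rho> r) \<and>
      counts A B' (seg (Suc t - n) (Suc t)) \<and>
      \<rho>' RF = freq_moment k (seg (Suc t - n) (Suc t))) ?\<rho> A B ys (5 + \<tau>)"
    by (rule wp_adjust[OF _ _ A s cnt]) (use c t F mem sg n in \<open>auto simp: constants_def\<close>)
  then have "wp (adjust k (Add RY RY ROne))
      (wp (OP (Add RT RT ROne) ;; IF (Lt RT RN) SKIP (OP (Emit RF))) ?Q) ?\<rho> A B ys (5 + \<tau>)"
    by (rule wp_mono) (use r t tw in \<open>auto\<close>)
  then show ?thesis
    unfolding wp_Seq[of "OP (Mov RP RT)"] wp_Seq[of "adjust k (Add RY RY ROne)"] wp_opers using t by simp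
qed

lemma wp_roll:
  assumes c: "constants \<rho>" and A: "positions A" and s: "sorted_on_range A 0 (2 * 2 ^ q)"
    and t: "\<rho> RT = t0" "t0 < 2 * n - 1"
    and cnt: "counts A B (seg (t0 - n) t0)" and F: "\<rho> RF = freq_moment k (seg (t0 - n) t0)"
    and out: "ys = outputs t0"
    and mem: "\<And>t. t0 \<le> t \<Longrightarrow> t < min (t0 + 2 ^ q) (2 * n - 1) \<Longrightarrow>
      (\<exists>j<2 * 2 ^ q. key (A j) = key t) \<and> (\<exists>j<2 * 2 ^ q. key (A j) = key (t - n))"
  shows "wp (roll k) (\<lambda>\<rho>' A' B' ys' \<tau>'. ys' = outputs (\<rho>' RT) \<and>
      \<tau>' \<le> \<tau> + 20 + 2 ^ q * (245 + 80 * q + 20 * k) \<and>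
      (\<forall>r. r \<notin> {RTE, RP, RPos, RStep, RX, RY, RG, RF, RT} \<longrightarrow> \<rho>' r = \<rho> r) \<and>
      \<rho>' RT = min (t0 + 2 ^ q) (2 * n - 1) \<and>
      \<rho>' RF = freq_moment k (seg (\<rho>' RT - n) (\<rho>' RT))) \<rho> A B ys \<tau>"
proof -
  \<comment> \<open>\<open>?C\<close> is the cost of one step: 5 for the loop test, plus the bounds
    of \<open>wp_remove\<close> and \<open>wp_insert\<close>.\<close>
  let ?e = "min (t0 + 2 ^ q) (2 * n - 1)" and ?C = "245 + 80 * q + 20 * k"
  define I where "I \<rho>' A' B' ys' \<tau>' \<longleftrightarrow> A' = A \<and> ys' = outputs (\<rho>' RT) \<and>
     \<tau>' \<le> \<tau> + 15 + (\<rho>' RT - t0) * ?C \<and>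
     (\<forall>r. r \<notin> {RTE, RP, RPos, RStep, RX, RY, RG, RF, RT} \<longrightarrow> \<rho>' r = \<rho> r) \<and> \<rho>' RTE = ?e \<and>
     t0 \<le> \<rho>' RT \<and> \<rho>' RT \<le> ?e \<and> counts A B' (seg (\<rho>' RT - n) (\<rho>' RT)) \<and>
     \<rho>' RF = freq_moment k (seg (\<rho>' RT - n) (\<rho>' RT))"
    for \<rho>' A' B' ys' and \<tau>' :: nat
  have r: "\<rho> RB = 2 ^ q" "\<rho> RE = 2 * n - 1" using c by (simp_all add: constants_def)
  have e: "t0 + 2 ^ q - (t0 + 2 ^ q - (2 * n - 1)) = ?e" by simp
  have start: "I (\<rho>(RX := t0 + 2 ^ q - (2 * n - 1), RTE := ?e)) A B ys (15 + \<tau>)"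
    using t cnt F out by (auto simp: I_def)
  have w: "t0 + 2 ^ q < 2 ^ w" using t block_le by (intro small) simp
  have "wp (WHILE (Lt RT RTE)
       (IF (Lt RT RN) SKIP (OP (Sub RP RT RN) ;; adjust k (Sub RY RY ROne)) ;;
        OP (Mov RP RT) ;; adjust k (Add RY RY ROne) ;; OP (Add RT RT ROne) ;;
        IF (Lt RT RN) SKIP (OP (Emit RF))))
     (\<lambda>\<rho>' A' B' ys' \<tau>'. ys' = outputs (\<rho>' RT) \<and> \<tau>' \<le> \<tau> + 20 + 2 ^ q * ?C \<and>
      (\<forall>r. r \<notin> {RTE, RP, RPos, RStep, RX, RY, RG, RF, RT} \<longrightarrow> \<rho>' r = \<rho> r) \<and>
      \<rho>' RT = ?e \<and> \<rho>' RF = freq_moment k (seg (\<rho>' RT - n) (\<rho>' RT)))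
     (\<rho>(RX := t0 + 2 ^ q - (2 * n - 1), RTE := ?e)) A B ys (15 + \<tau>)"
  proof (rule wp_While[where I = I and \<mu> = "\<lambda>\<rho>'. ?e - \<rho>' RT"])
    show "I (\<rho>(RX := t0 + 2 ^ q - (2 * n - 1), RTE := ?e)) A B ys (15 + \<tau>)" by (rule start)
  next
    fix \<rho>' A' B' ys' \<tau>'
    assume I: "I \<rho>' A' B' ys' \<tau>'" and "test_val (Lt RT RTE) \<rho>'"
    let ?t = "\<rho>' RT"
    have [simp]: "A' = A" and ys': "ys' = outputs ?t"
      and fr: "\<And>r. r \<notin> {RTE, RP, RPos, RStep, RX, RY, RG, RF, RT} \<Longrightarrow> \<rho>' r = \<rho> r"
      and time: "\<tau>' \<le> \<tau> + 15 + (?t - t0) * ?C" and le: "t0 \<le> ?t" and te: "\<rho>' RTE = ?e"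
      and cnt': "counts A B' (seg (?t - n) ?t)" and F': "\<rho>' RF = freq_moment k (seg (?t - n) ?t)"
      using I by (auto simp: I_def)
    have te': "?t < ?e" using \<open>test_val (Lt RT RTE) \<rho>'\<close> te by simp
    have c': "constants \<rho>'" using c fr by (auto simp: constants_def)
    have tx: "?t < length x" using te' length_x by simp
    obtain j j' where j: "j < 2 * 2 ^ q" "key (A j) = key ?t" "j' < 2 * 2 ^ q" "key (A j') = key (?t - n)"
      using mem[OF le te'] by blast
    note rem = wp_remove[OF c' A s refl tx cnt' F' j(3,4), where ys = ys' and \<tau> = "5 + \<tau>'"]
    show "wp (IF (Lt RT RN) SKIP (OP (Sub RP RT RN) ;; adjust k (Sub RY RY ROne)) ;;
        OP (Mov RP RT) ;; adjust k (Add RY RY ROne) ;; OP (Add RT RT ROne) ;;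
        IF (Lt RT RN) SKIP (OP (Emit RF)))
       (\<lambda>\<rho>'' A'' B'' ys'' \<tau>''. I \<rho>'' A'' B'' ys'' \<tau>'' \<and> ?e - \<rho>'' RT < ?e - \<rho>' RT)
       \<rho>' A' B' ys' (5 + \<tau>')"
      unfolding wp_Seq[of "IF _ _ _"] \<open>A' = A\<close>
    proof (rule wp_mono[OF rem], elim conjE)
      fix \<rho>1 A1 B1 ys1 \<tau>1
      assume p1: "A1 = A" "ys1 = ys'" "\<tau>1 \<le> 5 + \<tau>' + 115 + 40 * q + 10 * k"
        "\<forall>r. r \<notin> {RP, RPos, RStep, RX, RY, RG, RF} \<longrightarrow> \<rho>1 r = \<rho>' r"
        "counts A B1 (seg (Suc ?t - n) ?t)" "\<rho>1 RF = freq_moment k (seg (Suc ?t - n) ?t)"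
      have c1: "constants \<rho>1" using c' p1 by (auto simp: constants_def)
      have t1: "\<rho>1 RT = ?t" using p1 by simp
      show "wp (OP (Mov RP RT) ;; adjust k (Add RY RY ROne) ;; OP (Add RT RT ROne) ;;
          IF (Lt RT RN) SKIP (OP (Emit RF)))
         (\<lambda>\<rho>'' A'' B'' ys'' \<tau>''. I \<rho>'' A'' B'' ys'' \<tau>'' \<and> ?e - \<rho>'' RT < ?e - \<rho>' RT)
         \<rho>1 A1 B1 ys1 \<tau>1"
        unfolding p1(1,2)
      proof (rule wp_mono[OF wp_insert[OF c1 A s t1 tx p1(5,6) j(1,2)]], elim conjE)
        fix \<rho>2 A2 B2 ys2 \<tau>2
        assume p2: "A2 = A" "ys2 = ys' @ (if Suc ?t < n then [] else [freq_moment k (seg (Suc ?t - n) (Suc ?t))])"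
          "\<tau>2 \<le> \<tau>1 + 125 + 40 * q + 10 * k" "\<rho>2 RT = Suc ?t"
          "\<forall>r. r \<notin> {RP, RPos, RStep, RX, RY, RG, RF, RT} \<longrightarrow> \<rho>2 r = \<rho>1 r"
          "counts A B2 (seg (Suc ?t - n) (Suc ?t))" "\<rho>2 RF = freq_moment k (seg (Suc ?t - n) (Suc ?t))"
        have "(Suc ?t - t0) * ?C = ?C + (?t - t0) * ?C" using le by (simp add: Suc_diff_le)
        then have "\<tau>2 \<le> \<tau> + 15 + (Suc ?t - t0) * ?C" using p2(3) p1(3) time by linarith
        moreover have "\<forall>r. r \<notin> {RTE, RP, RPos, RStep, RX, RY, RG, RF, RT} \<longrightarrow> \<rho>2 r = \<rho> r" "\<rho>2 RTE = ?e"
          using p2(5) p1(4) fr te by auto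
        moreover have "ys2 = outputs (Suc ?t)" using p2(2) ys' by (simp add: outputs_Suc)
        ultimately show "I \<rho>2 A2 B2 ys2 \<tau>2 \<and> ?e - \<rho>2 RT < ?e - \<rho>' RT"
          unfolding I_def p2(4) using p2(1,6,7) le te' by (auto intro!: diff_less_mono2)
      qed
    qed
  next
    fix \<rho>' A' B' ys' \<tau>'
    assume I: "I \<rho>' A' B' ys' \<tau>'" and nt: "\<not> test_val (Lt RT RTE) \<rho>'"
    have "\<rho>' RTE = ?e" "\<rho>' RT \<le> ?e" using I unfolding I_def by blast+
    then have e: "\<rho>' RT = ?e" using nt unfolding test_val.simps by linarith
    have "(?e - t0) * ?C \<le> 2 ^ q * ?C" by (intro mult_le_mono1) simp
    moreover have "\<tau>' \<le> \<tau> + 15 + (?e - t0) * ?C" using I unfolding I_def e by blast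
    ultimately have "5 + \<tau>' \<le> \<tau> + 20 + 2 ^ q * ?C" by linarith
    then show "ys' = outputs (\<rho>' RT) \<and> 5 + \<tau>' \<le> \<tau> + 20 + 2 ^ q * ?C \<and>
      (\<forall>r. r \<notin> {RTE, RP, RPos, RStep, RX, RY, RG, RF, RT} \<longrightarrow> \<rho>' r = \<rho> r) \<and>
      \<rho>' RT = ?e \<and> \<rho>' RF = freq_moment k (seg (\<rho>' RT - n) (\<rho>' RT))"
      using I e unfolding I_def by blast
  qed simp
  then show ?thesis
    unfolding roll_def wp_Seq[of "OP _"] wp_opers using w by (simp add: r t e[unfolded One_nat_def])
qed

end

definition block :: "nat \<Rightarrow> com" where
  "block k = fill ;; merge_sort ;; clear ;; count ;; roll k"

definition main :: "nat \<Rightarrow> com" where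
  "main k = WHILE (Lt RT RE) (block k)"

section \<open>The program and its complexity\<close>

definition setup_lg :: com where
  "setup_lg = OP (Lit ROne 1) ;; OP (Lit RL 0) ;; OP (Lit RV 1) ;; OP (Add RX RN ROne) ;;
     WHILE (Lt RV RX) (OP (Add RV RV RV) ;; OP (Add RL RL ROne))"

text \<open>\<open>RB\<close> becomes the largest power of two not above \<open>S div lg n\<close>,
  or 1 if that quotient is 0. Adding 1 to the quotient turns the strict loop test into "at
  most".\<close>

definition setup_block :: com where
  "setup_block = OP (Quot RX RS RL) ;; OP (Add RX RX ROne) ;; OP (Lit RB 1) ;; OP (Add RNN RB RB) ;;
     WHILE (Lt RNN RX) (OP (Mov RB RNN) ;; OP (Add RNN RNN RNN)) ;;
     OP (Add RE RN RN) ;; OP (Sub RE RE ROne) ;; OP (Sub REM RE ROne)"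

text \<open>The two literals install the base addresses of the arrays, hence the compiled code
  begins at address 2.\<close>

definition program :: "nat \<Rightarrow> instr list" where
  "program k = [LITERAL 2 40, LITERAL 3 41] @ code 2 (setup_lg ;; setup_block ;; main k) @ [HALT]"

lemma ram_outputs_within_mono:
  assumes "ram_outputs_within P w m n S x T ys" "T \<le> T'"
  shows "ram_outputs_within P w m n S x T' ys"
proof -
  obtain t p M where "t \<le> T" "ram_steps P w m x t (ram_init w n S) = Some (p, M, ys)"
    "p < length P" "P ! p = HALT"
    using assms(1) unfolding ram_outputs_within_def by blast
  moreover have "t \<le> T'" using \<open>t \<le> T\<close> assms(2) by simp
  ultimately show ?thesis unfolding ram_outputs_within_def by blast
qed

lemma (in machine) program_correct:
  assumes e: "exec (setup_lg ;; setup_block ;; main k)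
      ((\<lambda>_. 0)(RN := n, RS := S), \<lambda>_. 0, \<lambda>_. 0, [], 0) (\<rho>, A, B, ys, \<tau>)"
    and nS: "n < 2 ^ w" "S < 2 ^ w"
  shows "ram_outputs_within (program k) w (40 + 2 * cap) n S x (2 + \<tau>) ys"
proof -
  let ?c = "setup_lg ;; setup_block ;; main k" and ?P = "program k"
  let ?M = "(\<lambda>_. 0)(0 := n, 1 := S, 2 := 40, 3 := 41 :: nat)"
  have c: "code_at ?P 0 [LITERAL 2 40, LITERAL 3 41]" "code_at ?P 2 (code 2 ?c)"
    "code_at ?P (2 + code_length ?c) [HALT]"
  proof -
    have "code_at ?P 0 ?P" by (simp add: code_at_def)
    then have "code_at ?P 0 ([LITERAL 2 40, LITERAL 3 41] @ code 2 ?c @ [HALT])"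
      by (simp only: program_def)
    then show "code_at ?P 0 [LITERAL 2 40, LITERAL 3 41]" "code_at ?P 2 (code 2 ?c)"
      "code_at ?P (2 + code_length ?c) [HALT]"
      unfolding code_at_append length_code
      by (simp_all del: code.simps code_length.simps flip: numeral_2_eq_2)
  qed
  have w: "40 < (2::nat) ^ w" "41 < (2::nat) ^ w"
  proof -
    have "\<not> w \<le> 5"
    proof
      assume "w \<le> 5"
      then have "(2::nat) ^ w \<le> 2 ^ 5" by (intro power_increasing) auto
      then show False using cells by simp
    qed
    then have "(2::nat) ^ 6 \<le> 2 ^ w" by (intro power_increasing) auto
    then show "40 < (2::nat) ^ w" "41 < (2::nat) ^ w" by simp_all
  qed
  have "represents ?M ((\<lambda>_. 0)(RN := n, RS := S)) (\<lambda>_. 0) (\<lambda>_. 0)"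
  proof -
    have "?M (addr r) = ((\<lambda>_. 0)(RN := n, RS := S)) r" for r by (cases r) simp_all
    then show ?thesis by (auto simp: represents_def)
  qed
  from code_correct[OF e this c(2)] obtain t M' where
    t: "steps ?P t (2, ?M, []) = Some (2 + code_length ?c, M', ys)" "t \<le> \<tau>"
    by (auto simp: reaches_def)
  have "steps ?P 2 (ram_init w n S) = Some (2, ?M, [])"
    using c(1) nS w by (auto simp: ram_steps_2 ram_step_def code_at_Cons ram_init_def)
  then have "steps ?P (2 + t) (ram_init w n S) = Some (2 + code_length ?c, M', ys)"
    unfolding ram_steps_add using t by simp
  moreover have "2 + code_length ?c < length ?P" "?P ! (2 + code_length ?c) = HALT"
    using c(3) by (simp_all only: code_at_Cons)
  ultimately show ?thesis
    unfolding ram_outputs_within_def using t(2) by (intro exI[of _ "2 + t"]) auto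
qed

context window_machine
begin

lemma wp_block:
  assumes c: "constants \<rho>" and t: "\<rho> RT = t0" "t0 < 2 * n - 1"
    and F: "\<rho> RF = freq_moment k (seg (t0 - n) t0)" and out: "ys = outputs t0"
  shows "wp (block k) (\<lambda>\<rho>' A' B' ys' \<tau>'. constants \<rho>' \<and> ys' = outputs (\<rho>' RT) \<and>
      \<tau>' \<le> \<tau> + n * (q + 1) * (1000 + 20 * k) \<and> \<rho>' RT = min (t0 + 2 ^ q) (2 * n - 1) \<and>
      \<rho>' RF = freq_moment k (seg (\<rho>' RT - n) (\<rho>' RT))) \<rho> A B ys \<tau>" (is "wp _ ?Q _ _ _ _ _")
proof -
  have t': "\<rho> RT < 2 * n - 1" using t by simp
  show ?thesis
    unfolding block_def wp_Seq
  proof (rule wp_mono[OF wp_fill[OF c t']], elim conjE)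
    fix \<rho>1 A1 B1 ys1 \<tau>1
    assume 1: "B1 = B" "ys1 = ys" "\<tau>1 \<le> \<tau> + 10 + 45 * 2 ^ q"
      "\<forall>r. r \<notin> {RI, RJ, RX, RY, RG} \<longrightarrow> \<rho>1 r = \<rho> r"
      "\<forall>j<2 ^ q. A1 j = min (\<rho> RT + j) (2 * n - 2) \<and> A1 (j + 2 ^ q) = \<rho> RT + j - n"
    have c1: "constants \<rho>1" using c 1(4) by (simp add: constants_def)
    have A1: "positions A1"
      unfolding positions_def
    proof (intro allI impI)
      fix i :: nat assume i: "i < 2 * 2 ^ q"
      show "A1 i < length x"
      proof (cases "i < 2 ^ q")
        case True
        then show ?thesis using 1(5) n length_x by auto
      next
        case False
        then have "i - 2 ^ q < 2 ^ q" using i by simp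
        from 1(5)[rule_format, OF this] have "A1 i = \<rho> RT + (i - 2 ^ q) - n" using False by simp
        then show ?thesis using i t block_le length_x n by linarith
      qed
    qed
    show "wp merge_sort (wp clear (wp count (wp (roll k) ?Q))) \<rho>1 A1 B1 ys1 \<tau>1"
    proof (rule wp_mono[OF wp_merge_sort[OF c1 A1]], elim conjE)
      fix \<rho>2 A2 B2 ys2 \<tau>2
      assume 2: "ys2 = ys1" "\<tau>2 \<le> \<tau>1 + 10 + (q + 1) * (30 + 130 * 2 ^ q)"
        "\<forall>r. r \<notin> {RH, RO, RI, RIE, RJ, RJE, RX, RY} \<longrightarrow> \<rho>2 r = \<rho>1 r"
        "sorted_on_range A2 0 (2 * 2 ^ q)" "A2 ` {..<2 * 2 ^ q} = A1 ` {..<2 * 2 ^ q}"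
      have c2: "constants \<rho>2" using c1 2(3) by (simp add: constants_def)
      have A2: "positions A2" using A1 2(5) by (simp add: positions_iff)
      \<comment> \<open>Before sorting, an entering position \<open>u\<close> stands at index
        \<open>u - t0\<close> and the leaving one \<open>2 ^ q\<close> further on. Clipping does not
        affect them because \<open>u\<close> lies inside the input; sorting preserves the set of
        entries.\<close>
      have mem: "(\<exists>j<2 * 2 ^ q. key (A2 j) = key u) \<and> (\<exists>j<2 * 2 ^ q. key (A2 j) = key (u - n))"
        if u: "t0 \<le> u" "u < min (t0 + 2 ^ q) (2 * n - 1)" for u
      proof -
        have j: "u - t0 < 2 ^ q" using u by auto
        have "A1 (u - t0) = u" "A1 ((u - t0) + 2 ^ q) = u - n"
          using 1(5)[rule_format, OF j] u t by auto
        then have "u \<in> A1 ` {..<2 * 2 ^ q}" "u - n \<in> A1 ` {..<2 * 2 ^ q}"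
          using j by (auto simp: image_iff intro: bexI[of _ "u - t0"] bexI[of _ "u - t0 + 2 ^ q"])
        then show ?thesis unfolding 2(5)[symmetric] by auto
      qed
      show "wp clear (wp count (wp (roll k) ?Q)) \<rho>2 A2 B2 ys2 \<tau>2"
      proof (rule wp_mono[OF wp_clear[OF c2]], elim conjE)
        fix \<rho>3 A3 and B3 :: "nat \<Rightarrow> nat" and ys3 \<tau>3
        assume 3: "A3 = A2" "ys3 = ys2" "\<tau>3 \<le> \<tau>2 + 10 + 30 * 2 ^ q"
          "\<forall>r. r \<noteq> RJ \<longrightarrow> \<rho>3 r = \<rho>2 r" "\<forall>j<2 * 2 ^ q. B3 j = 0"
        have c3: "constants \<rho>3" using c2 3(4) by (simp add: constants_def)
        have t3: "\<rho>3 RT = t0" "\<rho>3 RF = \<rho> RF" using t 1(4) 2(3) 3(4) by simp_all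
        have t3': "\<rho>3 RT \<le> length x" using t3 t length_x by simp
        show "wp count (wp (roll k) ?Q) \<rho>3 A3 B3 ys3 \<tau>3"
          unfolding 3(1)
        proof (rule wp_mono[OF wp_count[OF c3 A2 2(4) t3' 3(5)]], elim conjE)
          fix \<rho>4 A4 B4 ys4 \<tau>4
          assume 4: "A4 = A2" "ys4 = ys3" "\<tau>4 \<le> \<tau>3 + 10 + n * (100 + 40 * q)"
            "\<forall>r. r \<notin> {RP, RPos, RStep, RX, RY} \<longrightarrow> \<rho>4 r = \<rho>3 r"
            "counts A2 B4 (seg (\<rho>3 RT - n) (\<rho>3 RT))"
          have c4: "constants \<rho>4" using c3 4(4) by (simp add: constants_def)
          have t4: "\<rho>4 RT = t0" "\<rho>4 RF = freq_moment k (seg (t0 - n) t0)"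
            using t3 F 4(4) by simp_all
          have cnt: "counts A2 B4 (seg (t0 - n) t0)" using 4(5) t3 by simp
          have out4: "ys4 = outputs t0" using out 1(2) 2(1) 3(2) 4(2) by simp
          show "wp (roll k) ?Q \<rho>4 A4 B4 ys4 \<tau>4"
            unfolding 4(1)
          proof (rule wp_mono, rule wp_roll[OF c4 A2 2(4) t4(1) t(2) cnt t4(2) out4], erule (1) mem,
              elim conjE)
            fix \<rho>5 A5 B5 ys5 \<tau>5
            assume 5: "ys5 = outputs (\<rho>5 RT)" "\<tau>5 \<le> \<tau>4 + 20 + 2 ^ q * (245 + 80 * q + 20 * k)"
              "\<forall>r. r \<notin> {RTE, RP, RPos, RStep, RX, RY, RG, RF, RT} \<longrightarrow> \<rho>5 r = \<rho>4 r"
              "\<rho>5 RT = min (t0 + 2 ^ q) (2 * n - 1)"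
              "\<rho>5 RF = freq_moment k (seg (\<rho>5 RT - n) (\<rho>5 RT))"
            have c5: "constants \<rho>5" using c4 5(3) by (simp add: constants_def)
            \<comment> \<open>By \<open>b <= n\<close> the five phases are bounded by multiples of
              \<open>n\<close>, \<open>n * q\<close> and \<open>n * k\<close>. The products are
              expanded so that they act as atoms in linear arithmetic; 1000 generously exceeds the
              coefficients.\<close>
            define b where "b = (2::nat) ^ q"
            have "b \<le> n" "b * q \<le> n * q" "b * k \<le> n * k" "q \<le> n * q"
              using block_le n by (simp_all add: b_def)
            moreover have "(q + 1) * (30 + 130 * b) = 30 * q + 30 + 130 * b + 130 * (b * q)"
              "n * (100 + 40 * q) = 100 * n + 40 * (n * q)"
              "b * (245 + 80 * q + 20 * k) = 245 * b + 80 * (b * q) + 20 * (b * k)"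
              "n * (q + 1) * (1000 + 20 * k) =
                1000 * n + 1000 * (n * q) + 20 * (n * k) + 20 * (n * q * k)"
              by (simp_all add: algebra_simps)
            ultimately have "\<tau>5 \<le> \<tau> + n * (q + 1) * (1000 + 20 * k)"
              using 1(3) 2(2) 3(3) 4(3) 5(2) n unfolding b_def[symmetric] by linarith
            then show "?Q \<rho>5 A5 B5 ys5 \<tau>5" using 5 c5 by blast
          qed
        qed
      qed
    qed
  qed
qed

lemma wp_main:
  assumes c: "constants \<rho>" and t: "\<rho> RT = 0" "\<rho> RF = 0"
  shows "wp (main k) (\<lambda>\<rho>' A' B' ys' \<tau>'. ys' = outputs (2 * n - 1) \<and>
      \<tau>' \<le> \<tau> + 5 + (3 * n div 2 ^ q) * (5 + n * (q + 1) * (1000 + 20 * k))) \<rho> A B [] \<tau>"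
proof -
  let ?K = "5 + n * (q + 1) * (1000 + 20 * k)"
  \<comment> \<open>\<open>j\<close> counts the blocks done. The last block starts before
    \<open>2 * n - 1\<close> and has length at most \<open>n\<close>, so even without clipping its
    end is at most \<open>3 * n\<close>; this bounds the number of blocks by
    \<open>3 * n div 2 ^ q\<close>.\<close>
  define I where "I \<rho>' A' B' ys' \<tau>' \<longleftrightarrow> constants \<rho>' \<and> ys' = outputs (\<rho>' RT) \<and>
     \<rho>' RF = freq_moment k (seg (\<rho>' RT - n) (\<rho>' RT)) \<and>
     (\<exists>j. \<rho>' RT = min (j * 2 ^ q) (2 * n - 1) \<and> j * 2 ^ q \<le> 3 * n \<and> \<tau>' \<le> \<tau> + j * ?K)"
    for \<rho>' and A' B' :: "nat \<Rightarrow> nat" and ys' and \<tau>' :: nat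
  show ?thesis
    unfolding main_def
  proof (rule wp_While[where I = I and \<mu> = "\<lambda>\<rho>. 2 * n - 1 - \<rho> RT"])
    show "I \<rho> A B [] \<tau>"
      using c t n by (auto simp: I_def outputs_def seg_def freq_moment_def intro!: exI[of _ 0])
  next
    fix \<rho>' A' B' ys' \<tau>'
    assume I: "I \<rho>' A' B' ys' \<tau>'" and v: "test_val (Lt RT RE) \<rho>'"
    have c': "constants \<rho>'" and ys': "ys' = outputs (\<rho>' RT)"
      and F: "\<rho>' RF = freq_moment k (seg (\<rho>' RT - n) (\<rho>' RT))" using I by (auto simp: I_def)
    obtain j where j: "\<rho>' RT = min (j * 2 ^ q) (2 * n - 1)" "\<tau>' \<le> \<tau> + j * ?K"
      using I by (auto simp: I_def)
    have lt: "\<rho>' RT < 2 * n - 1" using v c' by (simp add: constants_def)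
    then have jt: "\<rho>' RT = j * 2 ^ q" using j by auto
    show "wp (block k) (\<lambda>\<rho>'' A'' B'' ys'' \<tau>''. I \<rho>'' A'' B'' ys'' \<tau>'' \<and>
       2 * n - 1 - \<rho>'' RT < 2 * n - 1 - \<rho>' RT) \<rho>' A' B' ys' (5 + \<tau>')"
    proof (rule wp_mono[OF wp_block[OF c' refl lt F ys']], elim conjE)
      fix \<rho>1 A1 B1 ys1 \<tau>1
      assume 1: "constants \<rho>1" "ys1 = outputs (\<rho>1 RT)"
        "\<tau>1 \<le> 5 + \<tau>' + n * (q + 1) * (1000 + 20 * k)"
        "\<rho>1 RT = min (\<rho>' RT + 2 ^ q) (2 * n - 1)" "\<rho>1 RF = freq_moment k (seg (\<rho>1 RT - n) (\<rho>1 RT))"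
      have "\<tau>1 \<le> \<tau> + Suc j * ?K" using 1(3) j(2) by simp
      moreover have "\<rho>1 RT = min (Suc j * 2 ^ q) (2 * n - 1)" using 1(4) jt by (simp add: add.commute)
      moreover have "Suc j * 2 ^ q \<le> 3 * n" using lt jt block_le by simp
      moreover have "2 * n - 1 - \<rho>1 RT < 2 * n - 1 - \<rho>' RT"
      proof -
        have "0 < (2::nat) ^ q" by simp
        then have "\<rho>' RT < \<rho>1 RT" using 1(4) lt by linarith
        then show ?thesis using lt by (intro diff_less_mono2) auto
      qed
      ultimately show "I \<rho>1 A1 B1 ys1 \<tau>1 \<and> 2 * n - 1 - \<rho>1 RT < 2 * n - 1 - \<rho>' RT"
        unfolding I_def using 1(1,2,5) by blast
    qed
  next
    fix \<rho>' A' B' ys' \<tau>'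
    assume I: "I \<rho>' A' B' ys' \<tau>'" and v: "\<not> test_val (Lt RT RE) \<rho>'"
    have c': "constants \<rho>'" and ys': "ys' = outputs (\<rho>' RT)" using I by (auto simp: I_def)
    obtain j where j: "\<rho>' RT = min (j * 2 ^ q) (2 * n - 1)" "j * 2 ^ q \<le> 3 * n" "\<tau>' \<le> \<tau> + j * ?K"
      using I by (auto simp: I_def)
    have "\<not> \<rho>' RT < 2 * n - 1" using v c' by (simp add: constants_def)
    then have e: "\<rho>' RT = 2 * n - 1" using j(1) by linarith
    have "j \<le> 3 * n div 2 ^ q" using j(2) by (simp add: less_eq_div_iff_mult_less_eq)
    then have "j * ?K \<le> (3 * n div 2 ^ q) * ?K" by (intro mult_le_mono1)
    then show "ys' = outputs (2 * n - 1) \<and> 5 + \<tau>' \<le> \<tau> + 5 + (3 * n div 2 ^ q) * ?K"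
      unfolding ys' e using j(3) by (intro conjI refl) linarith
  qed simp
qed

lemma outputs_final: "outputs (2 * n - 1) = sliding_window n (freq_moment k) x"
proof -
  have "seg i (i + n) = take n (drop i x)" if "i < n" for i
    using that length_x by (intro nth_equalityI) (auto simp: seg_def key_def)
  then show ?thesis
    using n by (simp add: outputs_def sliding_window_def Suc_diff_le mult_2)
qed

text \<open>The two conditions on \<open>l\<close> determine it as the number of binary digits of
  \<open>n\<close>, which repeated doubling finds as the first exponent with
  \<open>n < 2 ^ l\<close>.\<close>

lemma wp_setup_lg:
  assumes l: "n < 2 ^ l" "2 ^ l \<le> 2 * n" and \<rho>: "\<rho> RN = n"
  shows "wp setup_lg (\<lambda>\<rho>' A' B' ys' \<tau>'. ys' = ys \<and> \<tau>' \<le> \<tau> + 25 + 15 * l \<and> \<rho>' RL = l \<and> \<rho>' ROne = 1 \<and>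
      (\<forall>r. r \<notin> {ROne, RL, RV, RX} \<longrightarrow> \<rho>' r = \<rho> r)) \<rho> A B ys \<tau>"
proof -
  define I where "I \<rho>' A' B' ys' \<tau>' \<longleftrightarrow> ys' = ys \<and> \<rho>' ROne = 1 \<and> \<rho>' RX = Suc n \<and>
     (\<forall>r. r \<notin> {ROne, RL, RV, RX} \<longrightarrow> \<rho>' r = \<rho> r) \<and>
     (\<exists>i\<le>l. \<rho>' RL = i \<and> \<rho>' RV = 2 ^ i \<and> \<tau>' \<le> \<tau> + 20 + 15 * i)"
    for \<rho>' and A' B' :: "nat \<Rightarrow> nat" and ys' and \<tau>' :: nat
  have "wp (WHILE (Lt RV RX) (OP (Add RV RV RV) ;; OP (Add RL RL ROne)))
     (\<lambda>\<rho>' A' B' ys' \<tau>'. ys' = ys \<and> \<tau>' \<le> \<tau> + 25 + 15 * l \<and> \<rho>' RL = l \<and> \<rho>' ROne = 1 \<and>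
      (\<forall>r. r \<notin> {ROne, RL, RV, RX} \<longrightarrow> \<rho>' r = \<rho> r))
     (\<rho>(ROne := 1, RL := 0, RV := 1, RX := Suc n)) A B ys (20 + \<tau>)"
  proof (rule wp_While[where I = I and \<mu> = "\<lambda>\<rho>. Suc n - \<rho> RV"])
    fix \<rho>' A' B' ys' \<tau>'
    assume I: "I \<rho>' A' B' ys' \<tau>'" and v: "test_val (Lt RV RX) \<rho>'"
    obtain i where i: "i \<le> l" "\<rho>' RL = i" "\<rho>' RV = 2 ^ i" "\<tau>' \<le> \<tau> + 20 + 15 * i"
      using I by (auto simp: I_def)
    have le: "2 ^ i \<le> n" using v i I by (simp add: I_def)
    then have "i \<noteq> l" using l by auto
    then have il: "Suc i \<le> l" using i by simp
    have "i < 2 ^ i" by simp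
    then have "i < n" using le by linarith
    then have w: "2 ^ i + 2 ^ i < (2::nat) ^ w" "Suc i < 2 ^ w"
      using le by (auto intro!: small)
    have "0 < (2::nat) ^ i" by simp
    then have "Suc n - 2 * 2 ^ i < Suc n - 2 ^ i" using le by linarith
    moreover have "I (\<rho>'(RV := 2 * 2 ^ i, RL := Suc i)) A' B' ys' (15 + \<tau>')"
      using I i il unfolding I_def by auto
    ultimately show "wp (OP (Add RV RV RV) ;; OP (Add RL RL ROne))
       (\<lambda>\<rho>'' A'' B'' ys'' \<tau>''. I \<rho>'' A'' B'' ys'' \<tau>'' \<and> Suc n - \<rho>'' RV < Suc n - \<rho>' RV)
       \<rho>' A' B' ys' (5 + \<tau>')"
      using w I i by (simp add: I_def[THEN iffD1, OF I] mult_2[symmetric])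
  next
    fix \<rho>' A' B' ys' \<tau>'
    assume I: "I \<rho>' A' B' ys' \<tau>'" and v: "\<not> test_val (Lt RV RX) \<rho>'"
    obtain i where i: "i \<le> l" "\<rho>' RL = i" "\<rho>' RV = 2 ^ i" "\<tau>' \<le> \<tau> + 20 + 15 * i"
      using I by (auto simp: I_def)
    have lt: "n < 2 ^ i" using v i I by (simp add: I_def)
    have "i = l"
    proof (rule ccontr)
      assume "i \<noteq> l"
      then have "(2::nat) ^ Suc i \<le> 2 ^ l" using i by (intro power_increasing) auto
      then show False using lt l by simp
    qed
    then show "ys' = ys \<and> 5 + \<tau>' \<le> \<tau> + 25 + 15 * l \<and> \<rho>' RL = l \<and> \<rho>' ROne = 1 \<and>
      (\<forall>r. r \<notin> {ROne, RL, RV, RX} \<longrightarrow> \<rho>' r = \<rho> r)"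
      using I i by (auto simp: I_def)
  qed (auto simp: I_def)
  then show ?thesis
    unfolding setup_lg_def wp_Seq[of "OP _"] wp_opers
    using small[of 1] small[of "Suc n"] by (simp add: \<rho>)
qed

lemma wp_setup_block:
  assumes \<rho>: "\<rho> RN = n" "\<rho> RS = S" "\<rho> RL = l" "\<rho> ROne = 1" "\<rho> RZero = 0" and S: "S \<le> n"
    and q: "S div l < 2 * 2 ^ q" "q = 0 \<or> 2 ^ q \<le> S div l"
  shows "wp setup_block (\<lambda>\<rho>' A' B' ys' \<tau>'. ys' = ys \<and> \<tau>' \<le> \<tau> + 40 + 15 * q \<and> constants \<rho>' \<and>
      \<rho>' RT = \<rho> RT \<and> \<rho>' RF = \<rho> RF) \<rho> A B ys \<tau>" (is "wp _ ?Q _ _ _ _ _")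
proof -
  define d where "d = S div l"
  have dn: "d \<le> n" using S div_le_dividend[of S l] unfolding d_def by linarith
  define I where "I \<rho>' A' B' ys' \<tau>' \<longleftrightarrow> ys' = ys \<and> \<rho>' RX = Suc d \<and>
     (\<forall>r. r \<notin> {RB, RNN, RX} \<longrightarrow> \<rho>' r = \<rho> r) \<and>
     (\<exists>i\<le>q. \<rho>' RB = 2 ^ i \<and> \<rho>' RNN = 2 * 2 ^ i \<and> \<tau>' \<le> \<tau> + 20 + 15 * i)"
    for \<rho>' and A' B' :: "nat \<Rightarrow> nat" and ys' and \<tau>' :: nat
  have "wp (WHILE (Lt RNN RX) (OP (Mov RB RNN) ;; OP (Add RNN RNN RNN)))
     (wp (OP (Add RE RN RN) ;; OP (Sub RE RE ROne) ;; OP (Sub REM RE ROne)) ?Q)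
     (\<rho>(RX := Suc d, RB := 1, RNN := 2)) A B ys (20 + \<tau>)"
  proof (rule wp_While[where I = I and \<mu> = "\<lambda>\<rho>. Suc d - \<rho> RNN"])
    fix \<rho>' A' B' ys' \<tau>'
    assume I: "I \<rho>' A' B' ys' \<tau>'" and v: "test_val (Lt RNN RX) \<rho>'"
    obtain i where i: "i \<le> q" "\<rho>' RB = 2 ^ i" "\<rho>' RNN = 2 * 2 ^ i" "\<tau>' \<le> \<tau> + 20 + 15 * i"
      using I by (auto simp: I_def)
    have le: "2 * 2 ^ i \<le> d" using v i I by (simp add: I_def)
    then have "i \<noteq> q" using q(1) by (auto simp: d_def)
    then have il: "Suc i \<le> q" using i by simp
    have w: "2 * 2 ^ i + 2 * 2 ^ i < (2::nat) ^ w"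
      using le dn by (auto intro!: small)
    have "0 < (2::nat) ^ i" by simp
    then have "Suc d - 4 * 2 ^ i < Suc d - 2 * 2 ^ i" using le by linarith
    moreover have "I (\<rho>'(RB := 2 * 2 ^ i, RNN := 4 * 2 ^ i)) A' B' ys' (15 + \<tau>')"
      using I i il unfolding I_def by (auto intro!: exI[of _ "Suc i"])
    ultimately show "wp (OP (Mov RB RNN) ;; OP (Add RNN RNN RNN))
       (\<lambda>\<rho>'' A'' B'' ys'' \<tau>''. I \<rho>'' A'' B'' ys'' \<tau>'' \<and> Suc d - \<rho>'' RNN < Suc d - \<rho>' RNN)
       \<rho>' A' B' ys' (5 + \<tau>')"
      using w i by simp
  next
    fix \<rho>' A' B' ys' \<tau>'
    assume I: "I \<rho>' A' B' ys' \<tau>'" and v: "\<not> test_val (Lt RNN RX) \<rho>'"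
    obtain i where i: "i \<le> q" "\<rho>' RB = 2 ^ i" "\<rho>' RNN = 2 * 2 ^ i" "\<tau>' \<le> \<tau> + 20 + 15 * i"
      using I by (auto simp: I_def)
    have lt: "d < 2 * 2 ^ i" using v i I by (simp add: I_def)
    have iq: "i = q"
    proof (rule ccontr)
      assume "i \<noteq> q"
      then have "(2::nat) ^ Suc i \<le> 2 ^ q" using i by (intro power_increasing) auto
      moreover have "2 ^ q \<le> d" using q(2) i \<open>i \<noteq> q\<close> by (auto simp: d_def)
      ultimately show False using lt by simp
    qed
    have fr: "\<And>r. r \<notin> {RB, RNN, RX} \<Longrightarrow> \<rho>' r = \<rho> r" "ys' = ys" using I by (auto simp: I_def)
    have w: "n + n < 2 ^ w" by (intro small) simp
    show "wp (OP (Add RE RN RN) ;; OP (Sub RE RE ROne) ;; OP (Sub REM RE ROne)) ?Q \<rho>' A' B' ys' (5 + \<tau>')"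
      using i w fr \<rho> by (simp add: iq constants_def mult_2)
  qed (auto simp: I_def intro!: exI[of _ 0])
  moreover have "2 < (2::nat) ^ w" "1 < (2::nat) ^ w" "Suc d < 2 ^ w"
    using dn by (auto intro!: small)
  ultimately show ?thesis
    unfolding setup_block_def wp_Seq[of "OP _"] wp_opers wp_Seq[of "WHILE _ _"] using \<rho>
    by (simp add: d_def[symmetric] numeral_2_eq_2[symmetric] del: wp_Seq)
qed

lemma program_outputs:
  assumes l: "n < 2 ^ l" "2 ^ l \<le> 2 * n" and S: "S \<le> n"
    and q: "S div l < 2 * 2 ^ q" "q = 0 \<or> 2 ^ q \<le> S div l"
  shows "ram_outputs_within (program k) w (40 + 2 * cap) n S x
    (80 + 15 * l + 15 * q + (3 * n div 2 ^ q) * (5 + n * (q + 1) * (1000 + 20 * k)))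
    (sliding_window n (freq_moment k) x)"
proof -
  let ?\<rho> = "(\<lambda>_. 0)(RN := n, RS := S)"
  let ?T = "(3 * n div 2 ^ q) * (5 + n * (q + 1) * (1000 + 20 * k))"
  have "wp (setup_lg ;; setup_block ;; main k)
    (\<lambda>\<rho>' A' B' ys' \<tau>'. ys' = outputs (2 * n - 1) \<and> \<tau>' \<le> 70 + 15 * l + 15 * q + ?T)
    ?\<rho> (\<lambda>_. 0) (\<lambda>_. 0) [] 0"
    unfolding wp_Seq
  proof (rule wp_mono[OF wp_setup_lg[OF l]], simp, elim conjE)
    fix \<rho>1 A1 B1 and ys1 :: "nat list" and \<tau>1
    assume 1: "ys1 = []" "\<tau>1 \<le> 0 + 25 + 15 * l" "\<rho>1 RL = l" "\<rho>1 ROne = 1"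
      "\<forall>r. r \<notin> {ROne, RL, RV, RX} \<longrightarrow> \<rho>1 r = ?\<rho> r"
    have r1: "\<rho>1 RN = n" "\<rho>1 RS = S" "\<rho>1 RZero = 0" using 1(5) by auto
    show "wp setup_block (wp (main k) (\<lambda>\<rho>' A' B' ys' \<tau>'. ys' = outputs (2 * n - 1) \<and>
        \<tau>' \<le> 70 + 15 * l + 15 * q + ?T)) \<rho>1 A1 B1 ys1 \<tau>1"
    proof (rule wp_mono[OF wp_setup_block[OF r1(1,2) 1(3,4) r1(3) S q]], elim conjE)
      fix \<rho>2 A2 B2 ys2 \<tau>2
      assume 2: "ys2 = ys1" "\<tau>2 \<le> \<tau>1 + 40 + 15 * q" "constants \<rho>2" "\<rho>2 RT = \<rho>1 RT" "\<rho>2 RF = \<rho>1 RF"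
      have r2: "\<rho>2 RT = 0" "\<rho>2 RF = 0" "ys2 = []" using 2 1 by simp_all
      show "wp (main k) (\<lambda>\<rho>' A' B' ys' \<tau>'. ys' = outputs (2 * n - 1) \<and>
          \<tau>' \<le> 70 + 15 * l + 15 * q + ?T) \<rho>2 A2 B2 ys2 \<tau>2"
        unfolding r2(3)
        by (rule wp_mono[OF wp_main[OF 2(3) r2(1,2)]]) (use 1(2) 2(2) in linarith)
    qed
  qed
  then obtain \<rho>' A' B' \<tau>' where
    e: "exec (setup_lg ;; setup_block ;; main k) (?\<rho>, \<lambda>_. 0, \<lambda>_. 0, [], 0) (\<rho>', A', B', outputs (2 * n - 1), \<tau>')"
    and \<tau>': "\<tau>' \<le> 70 + 15 * l + 15 * q + ?T"
    unfolding wp_def by blast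
  have "n < 2 ^ w" "S < 2 ^ w" using S by (auto intro!: small)
  from program_correct[OF e this] show ?thesis
    unfolding outputs_final by (rule ram_outputs_within_mono) (use \<tau>' in linarith)
qed

end

section \<open>Choice of the block length and the word length\<close>

definition lg :: "nat \<Rightarrow> nat" where
  "lg n = nat \<lceil>log 2 (real n + 1)\<rceil>"

text \<open>The rounded-down binary logarithm of \<open>S div lg n\<close>, or 0 if the quotient is
  0. The latter does occur, for instance at \<open>n = 4\<close> and \<open>S = 2\<close>, because
  \<open>lg\<close> rounds up.\<close>

definition log_block :: "nat \<Rightarrow> nat \<Rightarrow> nat" where
  "log_block n S = (LEAST q. S div lg n < 2 * 2 ^ q)"

lemma lg_bounds:
  assumes "1 \<le> n"
  shows "n < 2 ^ lg n" "2 ^ lg n \<le> 2 * n" "1 \<le> lg n"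
proof -
  have pos: "0 < log 2 (real n + 1)" using assms by simp
  have "log 2 (real n + 1) \<le> real (lg n)" unfolding lg_def by linarith
  then have "real n + 1 \<le> 2 ^ lg n" by (simp add: log_le_iff powr_realpow)
  then have "real (n + 1) \<le> real (2 ^ lg n)" by simp
  then show lt: "n < 2 ^ lg n" unfolding of_nat_le_iff by simp
  show l1: "1 \<le> lg n" using pos unfolding lg_def by linarith
  have "real (lg n - 1) < log 2 (real n + 1)"
    using pos l1 unfolding lg_def by linarith
  then have "2 ^ (lg n - 1) < real n + 1" by (simp add: less_log_iff powr_realpow)
  then have "real (2 ^ (lg n - 1)) < real (n + 1)" by simp
  then have "2 ^ (lg n - 1) \<le> n" unfolding of_nat_less_iff by simp
  moreover have "(2::nat) ^ lg n = 2 * 2 ^ (lg n - 1)" using l1 by (cases "lg n") simp_all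
  ultimately show "2 ^ lg n \<le> 2 * n" by simp
qed

lemma log_block_bounds:
  "S div lg n < 2 * 2 ^ log_block n S"
  "log_block n S = 0 \<or> 2 ^ log_block n S \<le> S div lg n"
proof -
  have "S div lg n < 2 * 2 ^ (S div lg n)"
    using less_exp[of "S div lg n"] by linarith
  then show "S div lg n < 2 * 2 ^ log_block n S" unfolding log_block_def by (rule LeastI)
  show "log_block n S = 0 \<or> 2 ^ log_block n S \<le> S div lg n"
  proof (cases "log_block n S")
    case (Suc p)
    then have "\<not> S div lg n < 2 * 2 ^ p"
      using not_less_Least[of p "\<lambda>q. S div lg n < 2 * 2 ^ q"] unfolding log_block_def by simp
    then show ?thesis using Suc by simp
  qed simp
qed

text \<open>The last bound turns the factor \<open>q + 1\<close> in the cost of a block into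
  \<open>lg n\<close>; it follows from \<open>2 ^ q <= n < 2 ^ lg n\<close>.\<close>

lemma log_block_le:
  assumes "1 \<le> n" "S \<le> n"
  shows "2 ^ log_block n S \<le> max 1 (S div lg n)" "2 ^ log_block n S \<le> n" "log_block n S < lg n"
proof -
  show 1: "2 ^ log_block n S \<le> max 1 (S div lg n)" using log_block_bounds(2)[of n S] by auto
  have "S div lg n \<le> n" using assms(2) div_le_dividend[of S "lg n"] by linarith
  then show 2: "2 ^ log_block n S \<le> n" using 1 assms(1) by linarith
  have "(2::nat) ^ log_block n S < 2 ^ lg n" using 2 lg_bounds(1)[OF assms(1)] by linarith
  then show "log_block n S < lg n" by simp
qed

text \<open>As \<open>n + 1\<close> is at least 2, the factor 256 is at most
  \<open>(n + 1) ^ 8\<close>. Together with the exponent \<open>k + 2\<close> this is the origin of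
  the multiplier \<open>k + 10\<close>.\<close>

lemma word_large:
  assumes "1 \<le> n"
  shows "256 * (n + 1) ^ (k + 2) \<le> 2 ^ word_bits (k + 10) n"
proof -
  have "256 * (n + 1) ^ (k + 2) \<le> (n + 1) ^ 8 * (n + 1) ^ (k + 2)"
  proof (rule mult_le_mono1)
    have "(2::nat) ^ 8 \<le> (n + 1) ^ 8" using assms by (intro power_mono) auto
    then show "256 \<le> (n + 1) ^ 8" by simp
  qed
  also have "\<dots> = (n + 1) ^ (8 + (k + 2))" by (rule power_add[symmetric])
  also have "\<dots> = (n + 1) ^ (k + 10)" by (rule arg_cong[of _ _ "(^) (n + 1)"]) simp
  also have "\<dots> \<le> (2 ^ lg n) ^ (k + 10)"
    using lg_bounds(1)[OF assms] by (intro power_mono) auto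
  also have "\<dots> = 2 ^ word_bits (k + 10) n"
    unfolding word_bits_def lg_def[symmetric] by (simp add: power_mult mult.commute)
  finally show ?thesis .
qed

text \<open>Passing from \<open>n + 1\<close> to \<open>n\<close> and rounding up each cost at most
  1, and \<open>log 2 n\<close> is at least 1 for \<open>2 <= n\<close>. At \<open>n = 1\<close> the
  inequality fails.\<close>

lemma lg_le:
  assumes "2 \<le> n" shows "real (lg n) \<le> 3 * log 2 (real n)"
proof -
  have "log 2 (real n + 1) \<le> log 2 (2 * real n)" using assms by simp
  also have "\<dots> = log 2 (real n) + 1" using assms by (simp add: log_mult)
  finally have "log 2 (real n + 1) \<le> log 2 (real n) + 1" .
  moreover have "1 \<le> log 2 (real n)" using assms by (simp add: le_log_iff)
  ultimately show ?thesis unfolding lg_def by linarith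
qed

definition time_bound :: "nat \<Rightarrow> nat \<Rightarrow> nat \<Rightarrow> nat" where
  "time_bound k n S = 80 + 15 * lg n + 15 * log_block n S +
     (3 * n div 2 ^ log_block n S) * (5 + n * (log_block n S + 1) * (1000 + 20 * k))"

text \<open>40 fixed cells and two arrays with two slots per block position;
  \<open>max 1 (S div lg n)\<close> bounds the block length from above.\<close>

definition cells_used :: "nat \<Rightarrow> nat \<Rightarrow> nat" where
  "cells_used n S = 40 + 2 * (2 * max 1 (S div lg n))"

lemma program_computes:
  fixes x :: "'a::linorder list"
  assumes nS: "(n, S) \<in> space_bounds" and x: "length x = 2 * n - 1"
  shows "ram_outputs_within (program k) (word_bits (k + 10) n) (cells_used n S) n S x
    (time_bound k n S) (sliding_window n (freq_moment k) x)"
proof -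
  have n: "1 \<le> n" and S: "S \<le> n" using nS by (auto simp: space_bounds_def)
  let ?w = "word_bits (k + 10) n" and ?cap = "2 * max 1 (S div lg n)" and ?q = "log_block n S"
  have "S div lg n \<le> n" using S div_le_dividend[of S "lg n"] by linarith
  then have cap: "?cap \<le> 2 * n" using n by simp
  have "n + 1 \<le> (n + 1) ^ (k + 2)" by (rule self_le_power) simp_all
  then have cells: "40 + 2 * ?cap \<le> 2 ^ ?w" using word_large[OF n, of k] cap by linarith
  have room: "2 * 2 ^ ?q \<le> ?cap" using log_block_le(1)[OF n S] by linarith
  interpret window_machine ?w ?cap x n k ?q
    by unfold_locales (fact cells n x room log_block_le(2)[OF n S] word_large[OF n])+
  show ?thesis
    unfolding cells_used_def time_bound_def
    by (rule program_outputs[OF lg_bounds(1,2)[OF n] S log_block_bounds])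
qed

text \<open>The arrays take \<open>O(S + log n)\<close> bits by the choice of the block length, and
  the fixed cells \<open>O(log n)\<close>; both are \<open>O(S)\<close> because
  \<open>log n <= S\<close>. The program counter takes a constant number of bits.\<close>

lemma space_linear:
  assumes n: "2 \<le> n" and nS: "(n, S) \<in> space_bounds"
  shows "ram_space P (word_bits b n) (cells_used n S) \<le> (136 * b + nat \<lceil>log 2 (length P)\<rceil>) * S"
proof -
  have lS: "log 2 (real n) \<le> real S" using nS by (simp add: space_bounds_def)
  have "1 \<le> log 2 (real n)" using n by (simp add: le_log_iff)
  then have S: "1 \<le> S" using lS by linarith
  have l: "lg n \<le> 3 * S" using lg_le[OF n] lS by linarith
  have "(S div lg n) * lg n \<le> S" by simp
  moreover have "max 1 (S div lg n) * lg n \<le> lg n + S div lg n * lg n"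
    by (cases "S div lg n") simp_all
  moreover have "cells_used n S * lg n = 40 * lg n + 4 * (max 1 (S div lg n) * lg n)"
    unfolding cells_used_def by (simp only: add_mult_distrib mult.assoc[symmetric])
  ultimately have "cells_used n S * lg n \<le> 44 * lg n + 4 * S" by linarith
  \<comment> \<open>By \<open>lg n <= 3 * S\<close>, the constant is
    \<open>44 * 3 + 4\<close>.\<close>
  then have "cells_used n S * lg n \<le> 136 * S" using l by linarith
  then have "b * (cells_used n S * lg n) \<le> b * (136 * S)" by (rule mult_le_mono2)
  moreover have "cells_used n S * word_bits b n = b * (cells_used n S * lg n)"
    by (simp add: word_bits_def lg_def)
  moreover define d where "d = nat \<lceil>log 2 (length P)\<rceil>"
  moreover have "d \<le> d * S" using S by simp
  moreover have "(136 * b + d) * S = b * (136 * S) + d * S" by (simp add: algebra_simps)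
  ultimately show ?thesis
    unfolding ram_space_def d_def[symmetric] by linarith
qed

text \<open>Maximality of the block length gives \<open>S <= 2 * 2 ^ q * l\<close>, so the number of
  blocks times \<open>S\<close> is at most \<open>6 * (n * l)\<close>. The remaining factor, the
  cost of a block, is of order \<open>n * l\<close> as well.\<close>

lemma time_space_product:
  assumes n: "2 \<le> n" and nS: "(n, S) \<in> space_bounds"
  shows "time_bound k n S * S \<le> (6200 + 120 * k) * (n\<^sup>2 * (lg n)\<^sup>2)"
proof -
  define l q where "l = lg n" and "q = log_block n S"
  have S: "S \<le> n" using nS by (simp add: space_bounds_def)
  have n1: "1 \<le> n" using n by simp
  have l1: "1 \<le> l" using lg_bounds(3)[OF n1] by (simp add: l_def)
  have ql: "q + 1 \<le> l" using log_block_le(3)[OF n1 S] by (simp add: l_def q_def)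
  have "S div l < 2 * 2 ^ q" using log_block_bounds(1)[of S n] by (simp add: l_def q_def)
  then have SQ: "S \<le> 2 * 2 ^ q * l"
    using l1 by (simp add: div_less_iff_less_mult)
  define K where "K = 5 + n * (q + 1) * (1000 + 20 * k)"
  have nl: "1 \<le> n * l" using n1 l1 by (simp add: Suc_le_eq)
  have "n * (q + 1) * (1000 + 20 * k) \<le> n * l * (1000 + 20 * k)"
    using ql by (intro mult_le_mono) auto
  moreover have "n * l * (1005 + 20 * k) = n * l * (1000 + 20 * k) + 5 * (n * l)"
    by (simp add: algebra_simps)
  ultimately have K: "K \<le> n * l * (1005 + 20 * k)" using nl unfolding K_def by linarith
  have "(3 * n div 2 ^ q) * S \<le> (3 * n div 2 ^ q) * (2 * 2 ^ q * l)" using SQ by (rule mult_le_mono2)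
  also have "\<dots> = ((3 * n div 2 ^ q) * 2 ^ q) * (2 * l)" by simp
  also have "\<dots> \<le> (3 * n) * (2 * l)" by (intro mult_le_mono1) simp
  also have "\<dots> = 6 * (n * l)" by simp
  finally have "(3 * n div 2 ^ q) * S * K \<le> 6 * (n * l) * (n * l * (1005 + 20 * k))"
    using K by (rule mult_le_mono)
  \<comment> \<open>The setup takes \<open>O(log n)\<close> time and \<open>S <= n\<close>, so its
    share is absorbed in \<open>(n * l) * (n * l)\<close>.\<close>
  moreover have "(80 + 15 * l + 15 * q) * S \<le> (110 * (n * l)) * (n * l)"
  proof (rule mult_le_mono)
    have "l \<le> n * l" using n1 by simp
    then show "80 + 15 * l + 15 * q \<le> 110 * (n * l)" using ql nl by linarith
    have "n \<le> n * l" using l1 by simp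
    then show "S \<le> n * l" using S by linarith
  qed
  moreover have "time_bound k n S * S = (80 + 15 * l + 15 * q) * S + (3 * n div 2 ^ q) * S * K"
    unfolding time_bound_def K_def l_def q_def by (simp add: algebra_simps)
  ultimately have "time_bound k n S * S \<le>
      (110 * (n * l)) * (n * l) + 6 * (n * l) * (n * l * (1005 + 20 * k))" by linarith
  also have "\<dots> = (6140 + 120 * k) * (n\<^sup>2 * l\<^sup>2)" by (simp add: power2_eq_square algebra_simps)
  also have "\<dots> \<le> (6200 + 120 * k) * (n\<^sup>2 * l\<^sup>2)" by (intro mult_le_mono1) simp
  finally show ?thesis by (simp add: l_def)
qed

theorem theorem2p6:
  fixes k :: nat
  shows "\<exists>(P :: instr list) (b :: nat) (T :: nat \<Rightarrow> nat \<Rightarrow> nat) (m :: nat \<Rightarrow> nat \<Rightarrow> nat).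
    (\<forall>(n, S) \<in> space_bounds. \<forall>x :: 'a::linorder list. length x = 2 * n - 1 \<longrightarrow>
       ram_outputs_within P (word_bits b n) (m n S) n S x (T n S)
         (sliding_window n (freq_moment k) x)) \<and>
    (\<lambda>(n, S). real (ram_space P (word_bits b n) (m n S))) \<in> O[asymp_range](\<lambda>(n, S). real S) \<and>
    (\<lambda>(n, S). real (T n S) * real S)
      \<in> O[asymp_range](\<lambda>(n, S). (real n)\<^sup>2 * (log 2 (real n))\<^sup>2)"
proof (intro exI conjI)
  show "\<forall>(n, S) \<in> space_bounds. \<forall>x :: 'a list. length x = 2 * n - 1 \<longrightarrow>
     ram_outputs_within (program k) (word_bits (k + 10) n) (cells_used n S) n S x (time_bound k n S)
       (sliding_window n (freq_moment k) x)"
    using program_computes by blast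
next
  show "(\<lambda>(n, S). real (ram_space (program k) (word_bits (k + 10) n) (cells_used n S)))
      \<in> O[asymp_range](\<lambda>(n, S). real S)"
  proof (rule bigoI)
    let ?C = "136 * (k + 10) + nat \<lceil>log 2 (length (program k))\<rceil>"
    show "\<forall>\<^sub>F p in asymp_range.
        norm (case p of (n, S) \<Rightarrow> real (ram_space (program k) (word_bits (k + 10) n) (cells_used n S)))
        \<le> real ?C * norm (case p of (n, S) \<Rightarrow> real S)"
      unfolding asymp_range_def eventually_principal
    proof clarify
      fix n S :: nat assume "(n, S) \<in> space_bounds" "2 \<le> n"
      then have "real (ram_space (program k) (word_bits (k + 10) n) (cells_used n S)) \<le> real (?C * S)"
        by (intro of_nat_mono space_linear)
      then show "norm (real (ram_space (program k) (word_bits (k + 10) n) (cells_used n S)))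
          \<le> real ?C * norm (real S)"
        unfolding of_nat_mult by simp
    qed
  qed
next
  show "(\<lambda>(n, S). real (time_bound k n S) * real S)
      \<in> O[asymp_range](\<lambda>(n, S). (real n)\<^sup>2 * (log 2 (real n))\<^sup>2)"
  proof (rule bigoI)
    let ?C = "6200 + 120 * k"
    \<comment> \<open>The factor 9 is the square of the 3 in \<open>lg_le\<close>.\<close>
    show "\<forall>\<^sub>F p in asymp_range. norm (case p of (n, S) \<Rightarrow> real (time_bound k n S) * real S)
        \<le> (9 * real ?C) * norm (case p of (n, S) \<Rightarrow> (real n)\<^sup>2 * (log 2 (real n))\<^sup>2)"
      unfolding asymp_range_def eventually_principal
    proof clarify
      fix n S :: nat assume nS: "(n, S) \<in> space_bounds" and n: "2 \<le> n"
      have "(real (lg n))\<^sup>2 \<le> (3 * log 2 (real n))\<^sup>2" using lg_le[OF n] by (intro power_mono) auto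
      then have l: "(real (lg n))\<^sup>2 \<le> 9 * (log 2 (real n))\<^sup>2" by (simp add: power_mult_distrib)
      have "real (time_bound k n S * S) \<le> real (?C * (n\<^sup>2 * (lg n)\<^sup>2))"
        by (intro of_nat_mono time_space_product n nS)
      then have "real (time_bound k n S) * real S \<le> real ?C * ((real n)\<^sup>2 * (real (lg n))\<^sup>2)"
        by (simp only: of_nat_mult of_nat_power)
      also have "\<dots> \<le> real ?C * ((real n)\<^sup>2 * (9 * (log 2 (real n))\<^sup>2))"
        using l by (intro mult_left_mono) auto
      finally show "norm (real (time_bound k n S) * real S)
          \<le> (9 * real ?C) * norm ((real n)\<^sup>2 * (log 2 (real n))\<^sup>2)"
        by (simp add: algebra_simps)
    qed
  qed
qed

end
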